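(* Let $1\le q<\infty$, $1\le q_i<\infty$ for $i=1,\dots,m$ with $\sum_{i=1}^m\frac1{q_i}=\frac1q$. Let $1\le q^*,\xi,\eta<\infty$ and $-\frac1{q_i}<\lambda_i<0$ for all $i=1,\dots,m$. Let $\omega\in A_\xi(\mathbb{R}^n)$ and $v\in A_\eta(\mathbb{R}^n)$ have finite critical indices $r_\omega,r_v$ for the reverse Hölder condition, and suppose $\omega(B(0,R))\lesssim v(B(0,R))$ for all $R>0$ (with a constant independent of $R$). Assume $q>q^*\xi r'_\omega$, $\delta_1\in(1,r_\omega)$, $\delta_2\in(1,r_v)$, put $\lambda^*=\lambda_1+\cdots+\lambda_m$, and assume $$\mathcal{C}_4=\int_{\mathbb{R}^n}\frac{|\Phi(y)|}{|y|^n}\Big(\prod_{i=1}^m|\det A_i^{-1}(y)|^{\frac{\xi}{q_i}}\|A_i(y)\|^{\frac{\xi n}{q_i}}\Big)\mathcal{A}(y)\,dy<\infty,$$ where $$\begin{aligned}\mathcal{A}(y)=&\prod_{i=1}^m\Big(\|A_i(y)\|^{n(\lambda_i+\frac1{q_i})\frac{\delta_2-1}{\delta_2}}\chi_{\{y:\|A_i(y)\|\le1\}}+\|A_i(y)\|^{n\eta(\lambda_i+\frac1{q_i})}\chi_{\{y:\|A_i(y)\|>1\}}\Big)\\&\times\prod_{i=1}^m\Big(\|A_i(y)\|^{-\frac{n}{q_i}\frac{\delta_1-1}{\delta_1}}\chi_{\{y:\|A_i(y)\|>1\}}+\|A_i(y)\|^{-\frac{\xi n}{q_i}}\chi_{\{y:\|A_i(y)\|\le1\}}\Big).\end{aligned}$$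 Then $\mathcal{H}_{\Phi,\vec{A}}$ is bounded from $\prod_{i=1}^m\dot{M}^{q_i,\lambda_i}_{v,\omega}(\mathbb{R}^n)$ to $\dot{M}^{q^*,\lambda^*}_{v,\omega}(\mathbb{R}^n)$.
   Context: $n,m\ge 1$ are integers. $\Phi$ is a locally integrable function on $\mathbb{R}^n$; $A_1,\dots,A_m$ are measurable functions on $\mathbb{R}^n$ with values in the $n\times n$ real matrices, with $\det A_i(y)\ne0$ for almost every $y$ in the support of $\Phi$ (integrands are read as $0$ where $\Phi(y)=0$). For a matrix $A=(a_{ij})$, $\|A\|=\big(\sum_{i,j=1}^n|a_{ij}|^2\big)^{1/2}$; $A_i^{-1}(y)$ is the inverse of $A_i(y)$; $\chi_E$ is the characteristic function of $E$. The multilinear Hausdorff operator is, for $\vec f=(f_1,\dots,f_m)$ with $f_i$ complex-valued measurable functions on $\mathbb{R}^n$, $$\mathcal{H}_{\Phi,\vec{A}}(\vec{f})(x)=\int_{\mathbb{R}^n}\frac{\Phi(y)}{|y|^n}\prod_{i=1}^m f_i(A_i(y)x)\,dy,\qquad x\in\mathbb{R}^n.$$ A weight is a nonnegative locally integrable function on $\mathbb{R}^n$; $v(E)=\int_Ev(x)\,dx$; $B(0,R)$ is the ball of radius $R$ centered at $0$. Muckenhoupt classes: for $1<\xi<\infty$, $\omega\in A_\xi(\mathbb{R}^n)$ if there is $C>0$ with $\big(\frac1{|B|}\int_B\omega\,dx\big)\big(\frac1{|B|}\int_B\omega^{-\frac1{\xi-1}}dx\big)^{\xi-1}\le C$ for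 all balls $B$; $\omega\in A_1(\mathbb{R}^n)$ if there is $C>0$ with $\frac1{|B|}\int_B\omega\,dx\le C\operatorname{ess\,inf}_{x\in B}\omega(x)$ for all balls $B$. Reverse Hölder: for $r>1$, $\omega\in RH_r$ if there is $C$ with $\big(\frac1{|B|}\int_B\omega^r\,dx\big)^{1/r}\le\frac{C}{|B|}\int_B\omega\,dx$ for all balls $B$; the critical index is $r_\omega=\sup\{r>1:\omega\in RH_r\}$. $r'_\omega$ is the conjugate exponent: $\frac1{r_\omega}+\frac1{r'_\omega}=1$. Two weighted central Morrey space: for weights $v,\omega$, $0<q<\infty$ and $\lambda\in\mathbb{R}$ with $1+\lambda q>0$, $\dot{M}^{q,\lambda}_{v,\omega}(\mathbb{R}^n)$ is the set of measurable $f$ with $\int_K|f|^q\omega\,dx<\infty$ for all compact $K\subset\mathbb{R}^n$ and $$\|f\|_{\dot{M}^{q,\lambda}_{v,\omega}(\mathbb{R}^n)}=\sup_{R>0}\frac{1}{v(B(0,R))^{\lambda+\frac1q}}\Big(\int_{B(0,R)}|f(x)|^q\omega(x)\,dx\Big)^{1/q}<\infty.$$ Boundedness of an $m$-linear operator $T$ from $\prod X_i$ to $Y$ means that there is a constant $C$ with $\|T(\vec f)\|_Y\le C\prod_i\|f_i\|_{X_i}$ for all $f_i\in X_i$, $T(\vec f)$ being well defined almost everywhere. $a\lesssim b$ means $a\le Cb$ for a constant $C>0$. *)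

theory Defs
  imports "HOL-Analysis.Analysis"
begin

(* Matrices are elements of real^'n^'n; the library norm there is already the
   Euclidean norm of the entries. *)
lemma norm_matrix_entries:
  fixes A :: "real^'n^'n"
  shows "norm A = sqrt (\<Sum>i\<in>UNIV. \<Sum>j\<in>UNIV. \<bar>A $ i $ j\<bar>\<^sup>2)"
  by (simp add: norm_vec_def L2_set_def sum_nonneg)

(* Real powers on [0,\<infinity>]. Unlike powr on the reals, a negative power of 0 is \<infinity>; this
   matters for the A_\<xi> condition, where a weight may vanish at some points. *)
definition epowr :: "ennreal \<Rightarrow> real \<Rightarrow> ennreal" where
  "epowr x a =
     (if a = 0 then 1
      else if x = 0 then (if a > 0 then 0 else top)
      else if x = top then (if a > 0 then top else 0)
      else ennreal (enn2real x powr a))"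

definition locally_integrable ::
  "('a::euclidean_space \<Rightarrow> 'b::{banach, second_countable_topology}) \<Rightarrow> bool" where
  "locally_integrable f \<longleftrightarrow> (\<forall>K. compact K \<longrightarrow> set_integrable lebesgue K f)"

definition weight :: "('a::euclidean_space \<Rightarrow> real) \<Rightarrow> bool" where
  "weight w \<longleftrightarrow> (\<forall>x. 0 \<le> w x) \<and> locally_integrable w"

definition weight_measure :: "('a::euclidean_space \<Rightarrow> real) \<Rightarrow> 'a set \<Rightarrow> ennreal" where
  "weight_measure w E = (\<integral>\<^sup>+x\<in>E. ennreal (w x) \<partial>lebesgue)"

definition average :: "'a::euclidean_space set \<Rightarrow> ('a \<Rightarrow> ennreal) \<Rightarrow> ennreal" where
  "average B g = (\<integral>\<^sup>+x\<in>B. g x \<partial>lebesgue) / emeasure lebesgue B"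

definition essinf_on :: "'a::euclidean_space set \<Rightarrow> ('a \<Rightarrow> ennreal) \<Rightarrow> ennreal" where
  "essinf_on B g = Sup {c. AE x in lebesgue. x \<in> B \<longrightarrow> c \<le> g x}"

(* Only meaningful for \<xi> \<ge> 1. *)
definition muckenhoupt :: "real \<Rightarrow> ('a::euclidean_space \<Rightarrow> real) \<Rightarrow> bool" where
  "muckenhoupt \<xi> w \<longleftrightarrow> weight w \<and>
     (if \<xi> = 1
      then \<exists>C>0. \<forall>x r. r > 0 \<longrightarrow>
             average (ball x r) (\<lambda>z. ennreal (w z))
               \<le> ennreal C * essinf_on (ball x r) (\<lambda>z. ennreal (w z))
      else \<exists>C>0. \<forall>x r. r > 0 \<longrightarrow>
             average (ball x r) (\<lambda>z. ennreal (w z))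
               * epowr (average (ball x r) (\<lambda>z. epowr (ennreal (w z)) (- 1 / (\<xi> - 1)))) (\<xi> - 1)
               \<le> ennreal C)"

definition reverse_holder :: "real \<Rightarrow> ('a::euclidean_space \<Rightarrow> real) \<Rightarrow> bool" where
  "reverse_holder r w \<longleftrightarrow>
     (\<exists>C>0. \<forall>x \<rho>. \<rho> > 0 \<longrightarrow>
        epowr (average (ball x \<rho>) (\<lambda>z. epowr (ennreal (w z)) r)) (1 / r)
          \<le> ennreal C * average (ball x \<rho>) (\<lambda>z. ennreal (w z)))"

definition critical_index :: "('a::euclidean_space \<Rightarrow> real) \<Rightarrow> ereal" where
  "critical_index w = Sup {ereal r |r. r > 1 \<and> reverse_holder r w}"

(* The two weighted central Morrey space, for 0 < q and 1 + \<lambda> * q > 0. *)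
definition morrey_norm ::
  "('a::euclidean_space \<Rightarrow> real) \<Rightarrow> ('a \<Rightarrow> real) \<Rightarrow> real \<Rightarrow> real \<Rightarrow> ('a \<Rightarrow> complex) \<Rightarrow> ennreal" where
  "morrey_norm v w q l f =
     (SUP R\<in>{0<..}. 1 / epowr (weight_measure v (ball 0 R)) (l + 1 / q)
        * epowr (\<integral>\<^sup>+x\<in>ball 0 R. ennreal (norm (f x) powr q * w x) \<partial>lebesgue) (1 / q))"

definition morrey_space ::
  "('a::euclidean_space \<Rightarrow> real) \<Rightarrow> ('a \<Rightarrow> real) \<Rightarrow> real \<Rightarrow> real \<Rightarrow> ('a \<Rightarrow> complex) set" where
  "morrey_space v w q l =
     {f. f \<in> borel_measurable lebesgue
       \<and> (\<forall>K. compact K \<longrightarrow> (\<integral>\<^sup>+x\<in>K. ennreal (norm (f x) powr q * w x) \<partial>lebesgue) < \<infinity>)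
       \<and> morrey_norm v w q l f < \<infinity>}"

(* The families A and f are indexed by {1..m}; their values at other indices are never used. *)
definition hausdorff_integrand ::
  "nat \<Rightarrow> (real^'n \<Rightarrow> complex) \<Rightarrow> (nat \<Rightarrow> real^'n \<Rightarrow> real^'n^'n) \<Rightarrow>
   (nat \<Rightarrow> real^'n \<Rightarrow> complex) \<Rightarrow> real^'n \<Rightarrow> real^'n \<Rightarrow> complex" where
  "hausdorff_integrand m \<Phi> A f x y =
     \<Phi> y / of_real (norm y ^ CARD('n)) * (\<Prod>i=1..m. f i (A i y *v x))"

definition hausdorff_operator ::
  "nat \<Rightarrow> (real^'n \<Rightarrow> complex) \<Rightarrow> (nat \<Rightarrow> real^'n \<Rightarrow> real^'n^'n) \<Rightarrow>
   (nat \<Rightarrow> real^'n \<Rightarrow> complex) \<Rightarrow> real^'n \<Rightarrow> complex" where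
  "hausdorff_operator m \<Phi> A f x = (\<integral>y. hausdorff_integrand m \<Phi> A f x y \<partial>lebesgue)"

definition A_factor ::
  "nat \<Rightarrow> (nat \<Rightarrow> real^'n \<Rightarrow> real^'n^'n) \<Rightarrow> (nat \<Rightarrow> real) \<Rightarrow> (nat \<Rightarrow> real) \<Rightarrow>
   real \<Rightarrow> real \<Rightarrow> real \<Rightarrow> real \<Rightarrow> real^'n \<Rightarrow> real" where
  "A_factor m A q l \<xi> \<eta> \<delta>1 \<delta>2 y =
     (let n = real CARD('n) in
      (\<Prod>i=1..m.
          norm (A i y) powr (n * (l i + 1 / q i) * ((\<delta>2 - 1) / \<delta>2)) * indicator {y. norm (A i y) \<le> 1} y
        + norm (A i y) powr (n * \<eta> * (l i + 1 / q i)) * indicator {y. norm (A i y) > 1} y)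
    * (\<Prod>i=1..m.
          norm (A i y) powr (- (n / q i) * ((\<delta>1 - 1) / \<delta>1)) * indicator {y. norm (A i y) > 1} y
        + norm (A i y) powr (- (\<xi> * n / q i)) * indicator {y. norm (A i y) \<le> 1} y))"

definition C4 ::
  "nat \<Rightarrow> (real^'n \<Rightarrow> complex) \<Rightarrow> (nat \<Rightarrow> real^'n \<Rightarrow> real^'n^'n) \<Rightarrow> (nat \<Rightarrow> real) \<Rightarrow> (nat \<Rightarrow> real) \<Rightarrow>
   real \<Rightarrow> real \<Rightarrow> real \<Rightarrow> real \<Rightarrow> ennreal" where
  "C4 m \<Phi> A q l \<xi> \<eta> \<delta>1 \<delta>2 =
     (\<integral>\<^sup>+y. ennreal (norm (\<Phi> y) / norm y ^ CARD('n)
        * (\<Prod>i=1..m. \<bar>det (matrix_inv (A i y))\<bar> powr (\<xi> / q i)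
                     * norm (A i y) powr (\<xi> * real CARD('n) / q i))
        * A_factor m A q l \<xi> \<eta> \<delta>1 \<delta>2 y) \<partial>lebesgue)"

end

theory Submission
  imports Defs
begin

text \<open>For fixed \<open>y\<close> the \<open>L\<^sup>p\<close>-norm of \<open>\<Prod>i. f i (A i y *v x)\<close> over a centred ball of radius \<open>R\<close>,
  taken with respect to the weight \<open>\<omega>\<close>, is estimated by one application of Hoelder's inequality to the
  powers \<open>\<bar>f i\<bar> powr (q i / \<xi>)\<close> and \<open>\<omega> powr r\<close>, where \<open>1 / r = 1 - p * \<xi> / q\<close>. The condition
  \<open>q > p * \<xi> * r\<omega>'\<close> says precisely that \<open>r\<close> is below the critical index, so the last factor is controlled
  by a reverse Hoelder inequality. Having lost the weight, the other factors can be transformed by the linear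
  substitution \<open>z = A i y *v x\<close>; the \<open>A\<^sub>\<xi>\<close> condition reinstates the weight on the ball of radius
  \<open>norm (A i y) * R\<close>. Comparing the weights of the balls of radii \<open>R\<close> and \<open>norm (A i y) * R\<close>, by the
  reverse Hoelder condition or by the Muckenhoupt condition according to which ball is larger, produces the
  kernel of \<open>C4\<close>. Minkowski's integral inequality in \<open>y\<close> concludes.\<close>

section \<open>Linear substitution in Lebesgue integrals\<close>

text \<open>Three obstacles shape the details. (1) The zero weight satisfies
  \<open>muckenhoupt\<close>, because 0 * top = 0. Its critical index is infinite, so finiteness of
  the critical indices is what makes the weights of balls positive and \<omega> positive almost
  everywhere. Divisions by weights of balls and the return from the measure \<omega> dx to Lebesgue
  measure rest on this. (2) Lebesgue measurable functions need not compose to measurable ones, so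
  \<open>f i (A i y *v x)\<close> is not known to be measurable in the pair (x, y). The estimates
  are made for Borel representatives; as nonsingular matrices pull null sets back to null sets, the
  operator does not see the difference. (3) The exponents in Hoelder's inequality are p \<xi> / q i
  for the factors and 1 / r for the weight. With them all powers of the radius R cancel, and the
  power 1 - p / q of \<omega>(B(0,R)) is left over. The comparison of \<omega>(B(0,R)) with
  v(B(0,R)) turns it into a power of v(B(0,R)), which corrects the exponent from ls + 1 / q to ls +
  1 / p.\<close>

lemma norm_matrix_vector_mult_le:
  fixes A :: "real^'n^'m"
  shows "norm (A *v x) \<le> norm A * norm x"
proof -
  have "norm (A *v x) \<le> L2_set (\<lambda>i. norm (A $ i) * norm x) UNIV"
    unfolding norm_vec_def[of "A *v x"]
    by (intro L2_set_mono) (auto simp: matrix_vector_mul_component intro: Cauchy_Schwarz_ineq2)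
  also have "\<dots> = norm A * norm x"
    by (simp add: L2_set_left_distrib norm_vec_def[of A])
  finally show ?thesis .
qed

text \<open>\<open>measure_shear_interval\<close> wants the lower corner to have a nonnegative n-th
  coordinate. A shear is additive, so translating the box along axis n until that coordinate is 0
  reduces the general case to it.\<close>

lemma measure_shear_image:
  fixes m n :: "'n::finite"
  defines "T \<equiv> (\<lambda>x::real^'n. \<chi> i. if i = m then x $ m + x $ n else x $ i)"
  assumes "m \<noteq> n"
  shows "measure lebesgue (T ` cbox a b) = measure lebesgue (cbox a b)"
proof (cases "cbox a b = {}")
  case False
  define t :: "real^'n" where "t = axis n (a $ n)"
  have lin: "T (x + y) = T x + T y" for x y
    by (simp add: T_def vec_eq_iff)
  have eq: "cbox a b = (+) t ` cbox (a - t) (b - t)"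
    by (simp add: cbox_translation[symmetric])
  have "T ` cbox a b = (+) (T t) ` T ` cbox (a - t) (b - t)"
    unfolding eq image_image lin ..
  then have "measure lebesgue (T ` cbox a b) = measure lebesgue (T ` cbox (a - t) (b - t))"
    by (simp add: measure_translation)
  also have "\<dots> = measure lebesgue (cbox (a - t) (b - t))"
    unfolding T_def
  proof (rule measure_shear_interval[OF \<open>m \<noteq> n\<close>])
    show "cbox (a - t) (b - t) \<noteq> {}" using False eq by auto
    show "0 \<le> (a - t) $ n" by (simp add: t_def)
  qed
  also have "\<dots> = measure lebesgue (cbox a b)"
    unfolding eq by (simp only: measure_translation)
  finally show ?thesis .
qed auto

text \<open>The identity is multiplicative in A, so induction over elementary matrices leaves
  diagonal matrices, transpositions and shears. As an equality of measures it transforms integrals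
  of all nonnegative Borel functions at once.\<close>

lemma lborel_linear_image:
  fixes A :: "real^'n^'n"
  assumes "det A \<noteq> 0"
  shows "lborel = density (distr lborel borel ((*v) A)) (\<lambda>_. ennreal \<bar>det A\<bar>)"
proof -
  \<comment> \<open>The hypothesis stays inside the induction predicate because singular matrices
    occur among the cases; a zero row, for instance, makes the claim vacuous.\<close>
  have "det A \<noteq> 0 \<longrightarrow> lborel = density (distr lborel borel ((*v) A)) (\<lambda>_. ennreal \<bar>det A\<bar>)"
    (is "?P A")
  proof (induction A rule: induct_matrix_elementary_alt)
    case (1 A B)
    show ?case
    proof
      assume "det (A ** B) \<noteq> 0"
      then have nz: "det A \<noteq> 0" "det B \<noteq> 0" by (auto simp: det_mul)
      have [measurable]: "(*v) A \<in> borel \<rightarrow>\<^sub>M borel" "(*v) B \<in> borel \<rightarrow>\<^sub>M borel" "(*v) (A ** B) \<in> borel \<rightarrow>\<^sub>M borel"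
        by (auto intro!: borel_measurable_continuous_onI matrix_vector_mult_linear_continuous_on)
      have A: "lborel = density (distr lborel borel ((*v) A)) (\<lambda>_. ennreal \<bar>det A\<bar>)"
        and B: "lborel = density (distr lborel borel ((*v) B)) (\<lambda>_. ennreal \<bar>det B\<bar>)"
        using 1 nz by auto
      show "lborel = density (distr lborel borel ((*v) (A ** B))) (\<lambda>_. ennreal \<bar>det (A ** B)\<bar>)"
      proof (rule measure_eqI)
        fix X assume X: "X \<in> sets (lborel :: (real^'n) measure)"
        have 1: "emeasure lborel X = ennreal \<bar>det A\<bar> * emeasure lborel ((*v) A -` X)"
          using X by (subst A) (simp add: emeasure_density nn_integral_distr nn_integral_cmult emeasure_distr)
        have 2: "emeasure lborel ((*v) A -` X) = ennreal \<bar>det B\<bar> * emeasure lborel ((*v) B -` ((*v) A -` X))"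
          using X measurable_sets[of "(*v) A" borel borel X]
          by (subst B) (simp add: emeasure_density nn_integral_distr nn_integral_cmult emeasure_distr)
        have "(*v) B -` ((*v) A -` X) = (*v) (A ** B) -` X"
          by (auto simp: matrix_vector_mul_assoc)
        then show "emeasure lborel X = emeasure (density (distr lborel borel ((*v) (A ** B))) (\<lambda>_. ennreal \<bar>det (A ** B)\<bar>)) X"
          using X 1 2 by (simp add: emeasure_density nn_integral_distr nn_integral_cmult emeasure_distr det_mul abs_mult ennreal_mult mult.assoc)
      qed simp
    qed
  next
    case (2 A i)
    then show ?case by (metis det_zero_row(2))
  next
    case (3 A)
    show ?case
    proof
      assume nz: "det A \<noteq> 0"
      have det: "det A = (\<Prod>i\<in>UNIV. A $ i $ i)" using 3 by (intro det_diagonal)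
      \<comment> \<open>The diagonal entries as a function on \<open>Basis\<close>, the format of
        \<open>lborel_affine_euclidean\<close>, which settles this case with translation 0.\<close>
      define c :: "real^'n \<Rightarrow> real" where "c j = (A *v j) \<bullet> j" for j
      have cax: "c (axis k 1) = A $ k $ k" for k
        by (simp add: c_def inner_axis matrix_vector_mult_basis column_def)
      have Bas: "(Basis :: (real^'n) set) = (\<lambda>k. axis k 1) ` UNIV"
        by (auto simp: Basis_vec_def)
      have inj: "inj (\<lambda>k::'n. axis k (1::real))"
        by (auto simp: inj_on_def axis_eq_axis)
      have prod: "(\<Prod>j\<in>Basis. \<bar>c j\<bar>) = \<bar>det A\<bar>"
        unfolding Bas det by (subst prod.reindex[OF inj]) (simp add: cax abs_prod)
      have sum: "0 + (\<Sum>j\<in>Basis. (c j * (x \<bullet> j)) *\<^sub>R j) = A *v x" for x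
      proof -
        have "(A *v x) $ i = A $ i $ i * x $ i" for i
        proof -
          have "(A *v x) $ i = (\<Sum>j\<in>UNIV. if j = i then A $ i $ i * x $ i else 0)"
            unfolding matrix_vector_mult_def vec_lambda_beta by (intro sum.cong) (auto simp: 3)
          then show ?thesis by simp
        qed
        moreover have "(\<Sum>j\<in>Basis. (c j * (x \<bullet> j)) *\<^sub>R j) $ i = A $ i $ i * x $ i" for i
        proof -
          have "(\<Sum>j\<in>Basis. (c j * (x \<bullet> j)) *\<^sub>R j) $ i = (\<Sum>k\<in>UNIV. c (axis k 1) * (x \<bullet> axis k 1) * axis k 1 $ i)"
            unfolding Bas by (simp add: sum.reindex[OF inj] o_def)
          also have "\<dots> = (\<Sum>k\<in>UNIV. A $ k $ k * x $ k * axis k 1 $ i)"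
            by (simp only: cax inner_axis) simp
          also have "\<dots> = (\<Sum>k\<in>UNIV. if k = i then A $ i $ i * x $ i else 0)"
            by (intro sum.cong) (auto simp: axis_def)
          finally have "(\<Sum>j\<in>Basis. (c j * (x \<bullet> j)) *\<^sub>R j) $ i = (\<Sum>k\<in>UNIV. if k = i then A $ i $ i * x $ i else 0)" .
          then show ?thesis by simp
        qed
        ultimately show ?thesis by (simp add: vec_eq_iff)
      qed
      have "c j \<noteq> 0" if "j \<in> Basis" for j
        using nz that unfolding Bas det by (auto simp: cax)
      from lborel_affine_euclidean[of c 0, OF this]
      show "lborel = density (distr lborel borel ((*v) A)) (\<lambda>_. ennreal \<bar>det A\<bar>)"
        unfolding prod sum .
    qed
  next
    case (4 m n)
    let ?A = "\<chi> i j. mat 1 $ i $ Transposition.transpose m n j :: real^'n^'n"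
    have d: "\<bar>det ?A\<bar> = 1"
      by (simp add: det_permute_columns permutes_swap_id sign_swap_id)
    have mv: "?A *v x = (\<chi> i. x $ Transposition.transpose m n i)" for x
    proof -
      have "(\<Sum>j\<in>UNIV. (if i = Transposition.transpose m n j then 1 else 0) * x $ j) = x $ Transposition.transpose m n i" for i
      proof -
        have "(i = Transposition.transpose m n j) = (j = Transposition.transpose m n i)" for j
          by (metis transpose_involutory)
        then show ?thesis by (simp add: if_distrib[where f="\<lambda>z. z * _"] cong: if_cong)
      qed
      then show ?thesis by (simp add: vec_eq_iff matrix_vector_mult_def mat_def)
    qed
    have [measurable]: "(*v) ?A \<in> borel \<rightarrow>\<^sub>M borel"
      by (auto intro!: borel_measurable_continuous_onI matrix_vector_mult_linear_continuous_on)
    \<comment> \<open>Permuting coordinates maps boxes to boxes with the same side lengths, and a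
      Borel measure is determined by the volumes of boxes.\<close>
    have "lborel = distr lborel borel ((*v) ?A)"
    proof (rule lborel_eqI)
      fix l u :: "real^'n" assume lu: "\<And>b. b \<in> Basis \<Longrightarrow> l \<bullet> b \<le> u \<bullet> b"
      let ?s = "\<lambda>x::real^'n. \<chi> i. x $ Transposition.transpose m n i"
      have le: "l $ i \<le> u $ i" for i using lu[of "axis i 1"] by (simp add: inner_axis)
      have "(*v) ?A -` box l u = box (?s l) (?s u)"
        by (auto simp: mem_box_cart mv) (metis transpose_involutory)+
      moreover have "emeasure lborel (box (?s l) (?s u)) = (\<Prod>b\<in>Basis. (?s u - ?s l) \<bullet> b)"
        by (rule emeasure_lborel_box) (use le in \<open>auto simp: Basis_vec_def inner_axis\<close>)
      moreover have "(\<Prod>b\<in>Basis. (?s u - ?s l) \<bullet> b) = (\<Prod>b\<in>Basis. (u - l) \<bullet> b)"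
      proof -
        have Bas: "(Basis :: (real^'n) set) = (\<lambda>k. axis k 1) ` UNIV" by (auto simp: Basis_vec_def)
        have inj: "inj (\<lambda>k::'n. axis k (1::real))" by (auto simp: inj_on_def axis_eq_axis)
        show ?thesis unfolding Bas
          using prod.permute [OF permutes_swap_id[of m UNIV n], where g="\<lambda>i. u $ i - l $ i"]
          by (simp add: prod.reindex[OF inj] inner_axis o_def)
      qed
      ultimately show "emeasure (distr lborel borel ((*v) ?A)) (box l u) = ennreal (\<Prod>b\<in>Basis. (u - l) \<bullet> b)"
        by (simp add: emeasure_distr)
    qed simp
    then show ?case using d by (simp add: density_1)
  next
    case (5 m n)
    let ?A = "\<chi> i j. of_bool (i = m \<and> j = n \<or> i = j) :: real^'n^'n"
    let ?T = "\<lambda>x::real^'n. \<chi> i. if i = m then x $ m + x $ n else x $ i"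
    have "det (\<chi> k. if k = m then row m (mat 1 :: real^'n^'n) + 1 *s row n (mat 1) else row k (mat 1)) = 1"
      using det_row_operation[OF 5, where c=1 and A="mat 1 :: real^'n^'n"] by simp
    moreover have "(\<chi> k. if k = m then row m (mat 1 :: real^'n^'n) + 1 *s row n (mat 1) else row k (mat 1)) = ?A"
      using 5 by (auto simp: vec_eq_iff row_def mat_def)
    ultimately have d: "det ?A = 1" by simp
    have mv: "?A *v x = ?T x" for x
    proof -
      have "(\<Sum>j\<in>UNIV. of_bool (i = m \<and> j = n \<or> i = j) * x $ j) = (if i = m then x $ m + x $ n else x $ i)" for i
      proof -
        have "(\<Sum>j\<in>UNIV. of_bool (i = m \<and> j = n \<or> i = j) * x $ j)
          = (\<Sum>j\<in>UNIV. (if j = n then of_bool (i = m) * x $ j else 0) + (if j = i then x $ j else 0))"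
          using 5 by (intro sum.cong) auto
        then show ?thesis by (auto simp: sum.distrib)
      qed
      then show ?thesis by (simp add: vec_eq_iff matrix_vector_mult_def)
    qed
    have meas[measurable]: "(*v) ?A \<in> borel \<rightarrow>\<^sub>M borel"
      by (auto intro!: borel_measurable_continuous_onI matrix_vector_mult_linear_continuous_on)
    have "invertible ?A" unfolding invertible_det_nz d by simp
    then obtain B where B: "?A ** B = mat 1" "B ** ?A = mat 1"
      unfolding invertible_def by blast
    have surj: "surj ((*v) ?A)"
      by (rule surjI[of _ "(*v) B"]) (simp only: matrix_vector_mul_assoc B matrix_vector_mul_lid)
    have "lborel = distr lborel borel ((*v) ?A)"
    proof (rule lborel_eqI)
      fix l u :: "real^'n" assume lu: "\<And>b. b \<in> Basis \<Longrightarrow> l \<bullet> b \<le> u \<bullet> b"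
      \<comment> \<open>The preimage of a box under a shear is a parallelepiped.
        \<open>measure_linear_sufficient\<close> reduces its measure to images of boxes but asks for
        a set of finite measure; X is bounded because it lies in the image of the box under the
        inverse matrix B.\<close>
      define X where "X = (*v) ?A -` box l u"
      have "X \<in> sets lborel" using measurable_sets[OF meas, of "box l u"] by (simp add: X_def)
      moreover have "bounded X"
      proof -
        have "X \<subseteq> (*v) B ` box l u"
        proof
          fix x assume "x \<in> X"
          moreover have "x = B *v (?A *v x)" by (simp only: matrix_vector_mul_assoc B matrix_vector_mul_lid)
          ultimately show "x \<in> (*v) B ` box l u" unfolding X_def by blast
        qed
        moreover have "bounded ((*v) B ` box l u)"
          by (intro bounded_linear_image) auto
        ultimately show ?thesis by (rule bounded_subset[rotated])
      qed
      ultimately have X: "X \<in> lmeasurable"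
        by (simp add: bounded_set_imp_lmeasurable)
      have "measure lebesgue ((*v) ?A ` X) = measure lebesgue X"
      proof -
        have mvf: "(*v) ?A = ?T" by (rule ext) (rule mv)
        have "?T ` X \<in> lmeasurable \<and> 1 * measure lebesgue X = measure lebesgue (?T ` X)"
        proof (rule measure_linear_sufficient[OF _ X])
          show "linear ?T" using matrix_vector_mul_linear[of ?A] unfolding mvf .
          show "measure lebesgue (?T ` cbox a b) = 1 * measure lebesgue (cbox a b)" for a b
            using measure_shear_image[OF 5] by (simp only: mult_1)
        qed
        then show ?thesis unfolding mvf by (simp only: mult_1)
      qed
      moreover have "(*v) ?A ` X = box l u" unfolding X_def using surj by (simp add: surj_image_vimage_eq)
      ultimately have "measure lebesgue X = measure lebesgue (box l u)" by (simp only:)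
      then have "emeasure lebesgue X = emeasure lebesgue (box l u)"
        using emeasure_eq_measure2[OF X] emeasure_eq_measure2[of "box l u" lebesgue] by (simp only: lmeasurable_box)
      then have "emeasure lborel X = ennreal (\<Prod>b\<in>Basis. (u - l) \<bullet> b)"
        using \<open>X \<in> sets lborel\<close> lu by simp
      moreover have "emeasure (distr lborel borel ((*v) ?A)) (box l u) = emeasure lborel X"
        unfolding X_def by (subst emeasure_distr) (use meas in auto)
      ultimately show "emeasure (distr lborel borel ((*v) ?A)) (box l u) = ennreal (\<Prod>b\<in>Basis. (u - l) \<bullet> b)"
        by (simp only:)
    qed simp
    then show ?case unfolding d by (simp only: abs_one ennreal_1 density_1) simp
  qed
  then show ?thesis using assms by blast
qed

section \<open>Integral inequalities\<close>

text \<open>Jensen's inequality for exp at the points ln (x i).\<close>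

lemma weighted_geom_mean_le_arith_mean:
  fixes x \<theta> :: "'i \<Rightarrow> real"
  assumes "finite I" and x: "\<And>i. i \<in> I \<Longrightarrow> 0 \<le> x i"
    and \<theta>: "\<And>i. i \<in> I \<Longrightarrow> 0 \<le> \<theta> i" and sum: "(\<Sum>i\<in>I. \<theta> i) = 1"
  shows "(\<Prod>i\<in>I. x i powr \<theta> i) \<le> (\<Sum>i\<in>I. \<theta> i * x i)"
proof (cases "\<exists>i\<in>I. x i = 0")
  case True
  \<comment> \<open>\<open>0 powr a = 0\<close> for every a, also for a = 0, so one zero base makes
    the product vanish whatever its exponent.\<close>
  then have "(\<Prod>i\<in>I. x i powr \<theta> i) = 0" using \<open>finite I\<close> by (intro prod_zero) auto
  then show ?thesis using x \<theta> by (simp add: sum_nonneg)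
next
  case False
  then have pos: "0 < x i" if "i \<in> I" for i using x[OF that] that by (auto simp: less_le)
  have "I \<noteq> {}" using sum by auto
  have "(\<Prod>i\<in>I. x i powr \<theta> i) = exp (\<Sum>i\<in>I. \<theta> i *\<^sub>R ln (x i))"
    unfolding exp_sum[OF \<open>finite I\<close>] using pos by (intro prod.cong) (force simp: powr_def)+
  also have "\<dots> \<le> (\<Sum>i\<in>I. \<theta> i * exp (ln (x i)))"
    by (rule convex_on_sum[OF \<open>finite I\<close> \<open>I \<noteq> {}\<close> exp_convex sum]) (use \<theta> in auto)
  also have "\<dots> = (\<Sum>i\<in>I. \<theta> i * x i)" using pos by simp
  finally show ?thesis .
qed

text \<open>Normalise each F i by its bound J i, apply the weighted mean inequality pointwise and
  integrate. If some J i is 0, normalising is impossible, but then F i and with it the product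
  vanish almost everywhere. Real bounds J instead of the integrals themselves keep \<infinity> out
  of the powers.\<close>

lemma nn_integral_Holder:
  fixes F :: "'i \<Rightarrow> 'a \<Rightarrow> real" and \<theta> J :: "'i \<Rightarrow> real"
  assumes fin: "finite I"
    and F[measurable]: "\<And>i. i \<in> I \<Longrightarrow> F i \<in> borel_measurable M"
    and F0: "\<And>i x. i \<in> I \<Longrightarrow> 0 \<le> F i x"
    and \<theta>: "\<And>i. i \<in> I \<Longrightarrow> 0 \<le> \<theta> i" and sum: "(\<Sum>i\<in>I. \<theta> i) = 1"
    and J0: "\<And>i. i \<in> I \<Longrightarrow> 0 \<le> J i"
    and J: "\<And>i. i \<in> I \<Longrightarrow> (\<integral>\<^sup>+x. ennreal (F i x) \<partial>M) \<le> ennreal (J i)"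
  shows "(\<integral>\<^sup>+x. ennreal (\<Prod>i\<in>I. F i x powr \<theta> i) \<partial>M) \<le> ennreal (\<Prod>i\<in>I. J i powr \<theta> i)"
proof (cases "\<exists>i\<in>I. J i = 0")
  case True
  then obtain i where i: "i \<in> I" "J i = 0" by blast
  have "AE x in M. ennreal (F i x) = 0"
    using J[OF i(1)] i(2) F[OF i(1)] by (subst nn_integral_0_iff_AE[symmetric]) auto
  then have "AE x in M. ennreal (\<Prod>i\<in>I. F i x powr \<theta> i) = 0"
  proof eventually_elim
    case (elim x)
    then have "F i x = 0" using F0[OF i(1), of x] by simp
    then have "(\<Prod>i\<in>I. F i x powr \<theta> i) = 0" using fin i(1) by (intro prod_zero) auto
    then show ?case by simp
  qed
  then have "(\<integral>\<^sup>+x. ennreal (\<Prod>i\<in>I. F i x powr \<theta> i) \<partial>M) = (\<integral>\<^sup>+x. 0 \<partial>M)"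
    by (rule nn_integral_cong_AE)
  then show ?thesis by simp
next
  case False
  then have Jp: "0 < J i" if "i \<in> I" for i using J0[OF that] that by (auto simp: less_le)
  define P where "P = (\<Prod>i\<in>I. J i powr \<theta> i)"
  have P0: "0 \<le> P" unfolding P_def by (intro prod_nonneg) auto
  have nn: "0 \<le> \<theta> i / J i" if "i \<in> I" for i
    using Jp[OF that] \<theta>[OF that] by simp
  have pt: "(\<Prod>i\<in>I. F i x powr \<theta> i) \<le> P * (\<Sum>i\<in>I. \<theta> i / J i * F i x)" for x
  proof -
    have "(\<Prod>i\<in>I. F i x powr \<theta> i) = P * (\<Prod>i\<in>I. (F i x / J i) powr \<theta> i)"
      unfolding P_def prod.distrib[symmetric]
    proof (intro prod.cong refl)
      fix i assume i: "i \<in> I"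
      show "F i x powr \<theta> i = J i powr \<theta> i * (F i x / J i) powr \<theta> i"
        using Jp[OF i] F0[OF i, of x] by (simp add: powr_mult[symmetric])
    qed
    also have "\<dots> \<le> P * (\<Sum>i\<in>I. \<theta> i * (F i x / J i))"
      by (intro mult_left_mono weighted_geom_mean_le_arith_mean fin sum P0)
        (use Jp F0 \<theta> in \<open>auto intro: divide_nonneg_nonneg less_imp_le\<close>)
    finally show ?thesis by simp
  qed
  have "(\<integral>\<^sup>+x. ennreal (\<Prod>i\<in>I. F i x powr \<theta> i) \<partial>M)
      \<le> (\<integral>\<^sup>+x. ennreal P * (\<Sum>i\<in>I. ennreal (\<theta> i / J i) * ennreal (F i x)) \<partial>M)"
  proof (rule nn_integral_mono)
    fix x
    have "ennreal (\<Prod>i\<in>I. F i x powr \<theta> i) \<le> ennreal (P * (\<Sum>i\<in>I. \<theta> i / J i * F i x))"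
      using pt by (intro ennreal_leI)
    also have "\<dots> = ennreal P * ennreal (\<Sum>i\<in>I. \<theta> i / J i * F i x)"
      by (rule ennreal_mult'[OF P0])
    also have "ennreal (\<Sum>i\<in>I. \<theta> i / J i * F i x) = (\<Sum>i\<in>I. ennreal (\<theta> i / J i * F i x))"
      by (intro sum_ennreal[symmetric] mult_nonneg_nonneg nn F0)
    also have "\<dots> = (\<Sum>i\<in>I. ennreal (\<theta> i / J i) * ennreal (F i x))"
      using nn by (intro sum.cong ennreal_mult') auto
    finally show "ennreal (\<Prod>i\<in>I. F i x powr \<theta> i) \<le> ennreal P * (\<Sum>i\<in>I. ennreal (\<theta> i / J i) * ennreal (F i x))" .
  qed
  also have "\<dots> = ennreal P * (\<Sum>i\<in>I. ennreal (\<theta> i / J i) * (\<integral>\<^sup>+x. ennreal (F i x) \<partial>M))"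
    by (subst nn_integral_cmult, measurable) (subst nn_integral_sum, measurable, simp add: nn_integral_cmult)
  also have "\<dots> \<le> ennreal P * (\<Sum>i\<in>I. ennreal (\<theta> i / J i) * ennreal (J i))"
    by (intro mult_left_mono sum_mono J) auto
  also have "(\<Sum>i\<in>I. ennreal (\<theta> i / J i) * ennreal (J i)) = (\<Sum>i\<in>I. ennreal (\<theta> i))"
  proof (intro sum.cong refl)
    fix i assume i: "i \<in> I"
    show "ennreal (\<theta> i / J i) * ennreal (J i) = ennreal (\<theta> i)"
      using Jp[OF i] \<theta>[OF i] by (subst ennreal_mult[symmetric]) auto
  qed
  also have "\<dots> = 1" using sum \<theta> by (simp add: sum_ennreal)
  finally show ?thesis by (simp add: P_def)
qed

lemma nn_integral_Holder2:
  fixes f g :: "'a \<Rightarrow> real"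
  assumes [measurable]: "f \<in> borel_measurable M" "g \<in> borel_measurable M"
    and "\<And>x. 0 \<le> f x" "\<And>x. 0 \<le> g x" "0 \<le> a" "0 \<le> b" "a + b = 1" "0 \<le> J" "0 \<le> K"
    and J: "(\<integral>\<^sup>+x. ennreal (f x) \<partial>M) \<le> ennreal J" and K: "(\<integral>\<^sup>+x. ennreal (g x) \<partial>M) \<le> ennreal K"
  shows "(\<integral>\<^sup>+x. ennreal (f x powr a * g x powr b) \<partial>M) \<le> ennreal (J powr a * K powr b)"
proof -
  have "(\<integral>\<^sup>+x. ennreal (\<Prod>i\<in>UNIV. (if i then f else g) x powr (if i then a else b)) \<partial>M)
    \<le> ennreal (\<Prod>i\<in>UNIV. (if i then J else K) powr (if i then a else b))"
    by (rule nn_integral_Holder) (use assms in \<open>auto simp: UNIV_bool\<close>)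
  then show ?thesis by (simp add: UNIV_bool mult.commute)
qed

text \<open>Minkowski's integral inequality in the case where a pointwise bound \<open>K\<close> for the norms of the
  slices is known: Hoelder's inequality with respect to the weight \<open>K\<close> then reduces it to
  Tonelli's theorem.\<close>

lemma nn_integral_Minkowski:
  fixes F :: "'a \<Rightarrow> 'b \<Rightarrow> real" and K :: "'b \<Rightarrow> real"
  assumes "sigma_finite_measure M" "sigma_finite_measure N"
    and F[measurable]: "case_prod F \<in> borel_measurable (M \<Otimes>\<^sub>M N)" and F0: "\<And>x y. 0 \<le> F x y"
    and K[measurable]: "K \<in> borel_measurable N" and K0: "\<And>y. 0 \<le> K y"
    and p: "1 \<le> p" and c: "0 \<le> c" and \<kappa>0: "0 \<le> \<kappa>"
    and \<kappa>: "(\<integral>\<^sup>+y. ennreal (K y) \<partial>N) \<le> ennreal \<kappa>"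
    and slice: "AE y in N. (\<integral>\<^sup>+x. ennreal (F x y powr p) \<partial>M) \<le> ennreal ((K y * c) powr p)"
  shows "(AE x in M. (\<integral>\<^sup>+y. ennreal (F x y) \<partial>N) < \<infinity>)
    \<and> (\<integral>\<^sup>+x. ennreal (enn2real (\<integral>\<^sup>+y. ennreal (F x y) \<partial>N) powr p) \<partial>M) \<le> ennreal ((\<kappa> * c) powr p)"
proof -
  interpret M: sigma_finite_measure M by fact
  interpret N: sigma_finite_measure N by fact
  interpret P: pair_sigma_finite M N ..
  \<comment> \<open>Chosen so that F = G powr (1 / p) * K powr (1 - 1 / p) wherever K is positive,
    while integrating G in x costs exactly one factor K.\<close>
  define G where "G x y = F x y powr p * K y powr (1 - p)" for x y
  have G[measurable]: "case_prod G \<in> borel_measurable (M \<Otimes>\<^sub>M N)"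
    unfolding G_def by measurable
  \<comment> \<open>At K y = 0 the real power in G is 0 instead of infinite, so G loses F there. The
    slice bound saves the factorisation: it forces F to vanish almost everywhere above such
    y.\<close>
  have zero: "AE x in M. AE y in N. K y = 0 \<longrightarrow> F x y = 0"
  proof (subst P.AE_commute)
    show "{x \<in> space (M \<Otimes>\<^sub>M N). K (snd x) = 0 \<longrightarrow> F (fst x) (snd x) = 0} \<in> sets (M \<Otimes>\<^sub>M N)"
      by measurable
    show "AE y in N. AE x in M. K y = 0 \<longrightarrow> F x y = 0"
      using slice AE_space
    proof eventually_elim
      case (elim y)
      show ?case
      proof (cases "K y = 0")
        case True
        then have "AE x in M. ennreal (F x y powr p) = 0"
          using elim by (subst nn_integral_0_iff_AE[symmetric]) auto
        then show ?thesis by eventually_elim simp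
      qed auto
    qed
  qed
  have "(\<integral>\<^sup>+x. \<integral>\<^sup>+y. ennreal (G x y) \<partial>N \<partial>M) = (\<integral>\<^sup>+y. \<integral>\<^sup>+x. ennreal (G x y) \<partial>M \<partial>N)"
    by (rule P.Fubini'[symmetric]) measurable
  also have "\<dots> \<le> (\<integral>\<^sup>+y. ennreal (c powr p) * ennreal (K y) \<partial>N)"
  proof (rule nn_integral_mono_AE)
    show "AE y in N. (\<integral>\<^sup>+x. ennreal (G x y) \<partial>M) \<le> ennreal (c powr p) * ennreal (K y)"
      using slice AE_space
    proof eventually_elim
      case (elim y)
      have "(\<integral>\<^sup>+x. ennreal (G x y) \<partial>M) = ennreal (K y powr (1 - p)) * (\<integral>\<^sup>+x. ennreal (F x y powr p) \<partial>M)"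
        using elim by (subst nn_integral_cmult[symmetric]) (auto simp: G_def ennreal_mult mult.commute)
      also have "\<dots> \<le> ennreal (K y powr (1 - p)) * ennreal ((K y * c) powr p)"
        using elim by (intro mult_left_mono) auto
      also have "\<dots> = ennreal (c powr p * (K y powr (1 - p) * K y powr p))"
        using K0 c by (simp add: ennreal_mult[symmetric] powr_mult mult_ac)
      also have "K y powr (1 - p) * K y powr p = K y"
        using K0[of y] by (simp add: powr_add[symmetric])
      finally show ?case by (simp add: ennreal_mult K0)
    qed
  qed
  also have "\<dots> \<le> ennreal (c powr p) * ennreal \<kappa>"
    by (subst nn_integral_cmult) (auto intro!: mult_left_mono \<kappa>)
  finally have H: "(\<integral>\<^sup>+x. \<integral>\<^sup>+y. ennreal (G x y) \<partial>N \<partial>M) \<le> ennreal (c powr p * \<kappa>)"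
    using \<kappa>0 by (simp add: ennreal_mult)
  have Hfin: "AE x in M. (\<integral>\<^sup>+y. ennreal (G x y) \<partial>N) \<noteq> \<infinity>"
    by (rule nn_integral_PInf_AE) (use H in \<open>auto simp: top_unique\<close>)
  have key: "AE x in M. (\<integral>\<^sup>+y. ennreal (F x y) \<partial>N) < \<infinity> \<and>
      ennreal (enn2real (\<integral>\<^sup>+y. ennreal (F x y) \<partial>N) powr p) \<le> ennreal (\<kappa> powr (p - 1)) * (\<integral>\<^sup>+y. ennreal (G x y) \<partial>N)"
    using Hfin zero AE_space
  proof eventually_elim
    case (elim x)
    define h where "h = enn2real (\<integral>\<^sup>+y. ennreal (G x y) \<partial>N)"
    have h: "(\<integral>\<^sup>+y. ennreal (G x y) \<partial>N) = ennreal h" "0 \<le> h"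
      using elim(1) by (auto simp: h_def less_top)
    have "(\<integral>\<^sup>+y. ennreal (F x y) \<partial>N) = (\<integral>\<^sup>+y. ennreal (G x y powr (1 / p) * K y powr (1 - 1 / p)) \<partial>N)"
    proof (rule nn_integral_cong_AE)
      show "AE y in N. ennreal (F x y) = ennreal (G x y powr (1 / p) * K y powr (1 - 1 / p))"
        using elim(2)
      proof eventually_elim
        case (elim y)
        show ?case
        proof (cases "K y = 0")
          case False
          have "G x y powr (1 / p) * K y powr (1 - 1 / p) = F x y * (K y powr ((1 - p) / p) * K y powr (1 - 1 / p))"
            using p F0[of x y] K0[of y] by (simp add: G_def powr_mult powr_powr)
          also have "K y powr ((1 - p) / p) * K y powr (1 - 1 / p) = 1"
            using False p by (simp add: powr_add[symmetric] diff_divide_distrib)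
          finally show ?thesis by simp
        qed (use elim in auto)
      qed
    qed
    also have "\<dots> \<le> ennreal (h powr (1 / p) * \<kappa> powr (1 - 1 / p))"
      by (rule nn_integral_Holder2)
        (use elim(3) p K0 F0 h \<kappa> \<kappa>0 in \<open>auto simp: G_def intro!: mult_nonneg_nonneg\<close>)
    finally have le: "(\<integral>\<^sup>+y. ennreal (F x y) \<partial>N) \<le> ennreal (h powr (1 / p) * \<kappa> powr (1 - 1 / p))" .
    then have "enn2real (\<integral>\<^sup>+y. ennreal (F x y) \<partial>N) \<le> h powr (1 / p) * \<kappa> powr (1 - 1 / p)"
      by (intro enn2real_leI) auto
    then have "enn2real (\<integral>\<^sup>+y. ennreal (F x y) \<partial>N) powr p \<le> (h powr (1 / p) * \<kappa> powr (1 - 1 / p)) powr p"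
      using p by (intro powr_mono2) auto
    also have "\<dots> = \<kappa> powr (p - 1) * h"
      using p h(2) \<kappa>0 by (simp add: powr_mult powr_powr left_diff_distrib right_diff_distrib mult.commute)
    finally show ?case using le h by (auto simp: less_top[symmetric] top_unique ennreal_mult[symmetric])
  qed
  have "(\<integral>\<^sup>+x. ennreal (enn2real (\<integral>\<^sup>+y. ennreal (F x y) \<partial>N) powr p) \<partial>M)
      \<le> (\<integral>\<^sup>+x. ennreal (\<kappa> powr (p - 1)) * (\<integral>\<^sup>+y. ennreal (G x y) \<partial>N) \<partial>M)"
    by (rule nn_integral_mono_AE) (use key in eventually_elim, auto)
  also have "\<dots> \<le> ennreal (\<kappa> powr (p - 1)) * ennreal (c powr p * \<kappa>)"
    by (subst nn_integral_cmult) (auto intro!: mult_left_mono H)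
  also have "\<dots> = ennreal ((\<kappa> powr (p - 1) * \<kappa> powr 1) * c powr p)"
    using \<kappa>0 c by (simp add: ennreal_mult[symmetric] mult_ac)
  also have "\<dots> = ennreal ((\<kappa> * c) powr p)"
    using \<kappa>0 c by (simp only: powr_add[symmetric]) (simp add: powr_mult)
  finally show ?thesis using key by (auto elim: eventually_mono)
qed

section \<open>Muckenhoupt weights on centred balls\<close>

lemma pred_ball_lebesgue[measurable]:
  fixes c :: "'a::euclidean_space"
  shows "Measurable.pred lebesgue (\<lambda>x. x \<in> ball c R)" "Measurable.pred lebesgue (\<lambda>x::'a. norm x < R)"
proof -
  have "{x \<in> space lebesgue. x \<in> ball c R} \<in> sets lebesgue" by simp
  then show "Measurable.pred lebesgue (\<lambda>x. x \<in> ball c R)" by (simp add: pred_def)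
  have "{x::'a. norm x < R} = ball 0 R" by auto
  then show "Measurable.pred lebesgue (\<lambda>x::'a. norm x < R)" by (simp add: pred_def)
qed

lemma locally_integrable_imp_measurable:
  fixes f :: "'a::euclidean_space \<Rightarrow> 'b::{banach, second_countable_topology}"
  assumes "locally_integrable f"
  shows "f \<in> borel_measurable lebesgue"
proof (rule borel_measurable_LIMSEQ_metric)
  fix k :: nat
  show "(\<lambda>x. indicator (cball 0 (real k)) x *\<^sub>R f x) \<in> borel_measurable lebesgue"
    using assms unfolding locally_integrable_def set_integrable_def by (intro borel_measurable_integrable) auto
next
  fix x :: 'a
  have "eventually (\<lambda>k. indicator (cball 0 (real k)) x *\<^sub>R f x = f x) sequentially"
    using eventually_ge_at_top[of "nat \<lceil>norm x\<rceil>"] by eventually_elim (auto simp: indicator_def; linarith)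
  then show "(\<lambda>k. indicator (cball 0 (real k)) x *\<^sub>R f x) \<longlonglongrightarrow> f x"
    by (rule tendsto_eventually)
qed

section \<open>Extended powers and weights of centred balls\<close>

lemma measurable_epowr[measurable]: "(\<lambda>x. epowr x a) \<in> borel_measurable borel"
  unfolding epowr_def by measurable

lemma epowr_ennreal:
  assumes "0 < x" shows "epowr (ennreal x) a = ennreal (x powr a)"
  using assms by (auto simp: epowr_def)

lemma epowr_ennreal_pos:
  assumes "0 \<le> x" "0 < a" shows "epowr (ennreal x) a = ennreal (x powr a)"
  using assms by (auto simp: epowr_def)

text \<open>Morrey norms only see centred balls, where a weight has finite mass by local
  integrability. The real value makes \<open>powr\<close> and ordinary division available.\<close>

definition ball_weight :: "('a::euclidean_space \<Rightarrow> real) \<Rightarrow> real \<Rightarrow> real" where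
  "ball_weight w R = enn2real (weight_measure w (ball 0 R))"

lemma ball_weight_nonneg[simp]: "0 \<le> ball_weight w R"
  by (simp add: ball_weight_def)

lemma weight_measurable: "weight w \<Longrightarrow> w \<in> borel_measurable lebesgue"
  by (simp add: weight_def locally_integrable_imp_measurable)

lemma weight_nonneg: "weight w \<Longrightarrow> 0 \<le> w x"
  by (simp add: weight_def)

lemma weight_measure_ball:
  fixes w :: "'a::euclidean_space \<Rightarrow> real"
  assumes w: "weight w"
  shows "weight_measure w (ball x R) < \<infinity>"
proof -
  have "set_integrable lebesgue (cball x R) w"
    using w by (simp add: weight_def locally_integrable_def)
  then have "(\<integral>\<^sup>+y. ennreal (norm (indicator (cball x R) y *\<^sub>R w y)) \<partial>lebesgue) < \<infinity>"
    unfolding set_integrable_def integrable_iff_bounded by blast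
  moreover have "weight_measure w (ball x R) \<le> (\<integral>\<^sup>+y. ennreal (norm (indicator (cball x R) y *\<^sub>R w y)) \<partial>lebesgue)"
    unfolding weight_measure_def
    by (intro nn_integral_mono) (auto simp: indicator_def weight_nonneg[OF w])
  ultimately show ?thesis by simp
qed

lemma weight_measure_eq_ball_weight:
  "weight w \<Longrightarrow> weight_measure w (ball 0 R) = ennreal (ball_weight w R)"
  using weight_measure_ball[of w 0 R] by (simp add: ball_weight_def less_top)

lemma average_ball_le_imp:
  fixes c :: "'a::euclidean_space"
  assumes R: "0 < R" and a: "average (ball c R) h \<le> ennreal s"
  shows "(\<integral>\<^sup>+x\<in>ball c R. h x \<partial>lebesgue) \<le> ennreal (unit_ball_vol (real DIM('a)) * R ^ DIM('a)) * ennreal s"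
proof -
  define b where "b = unit_ball_vol (real DIM('a)) * R ^ DIM('a)"
  have b: "0 < b" using R by (simp add: b_def)
  let ?I = "\<integral>\<^sup>+x\<in>ball c R. h x \<partial>lebesgue"
  have "?I / ennreal b \<le> ennreal s"
    using a R by (simp add: average_def emeasure_ball b_def)
  then have "ennreal b * (?I / ennreal b) \<le> ennreal b * ennreal s"
    by (intro mult_left_mono) auto
  moreover have "ennreal b * (?I / ennreal b) = ?I"
    using b by (simp add: ennreal_times_divide mult_divide_eq_ennreal mult.commute[of "ennreal b"])
  ultimately show ?thesis by (simp add: b_def)
qed

lemma average_weight:
  fixes w :: "'a::euclidean_space \<Rightarrow> real"
  assumes "weight w" "0 < R"
  shows "average (ball 0 R) (\<lambda>z. ennreal (w z))
    = ennreal (ball_weight w R / (unit_ball_vol (real DIM('a)) * R ^ DIM('a)))"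
  using assms(2) unfolding average_def weight_measure_def[symmetric] weight_measure_eq_ball_weight[OF assms(1)]
  by (simp add: emeasure_ball divide_ennreal)

lemma muckenhoupt_weight: "muckenhoupt \<xi> w \<Longrightarrow> weight w"
  by (simp add: muckenhoupt_def)

section \<open>The Muckenhoupt condition as an inequality for functions\<close>

text \<open>Almost everywhere on the ball the weight is at least a constant times its average, by
  the A_1 condition. Multiplying this by g and integrating gives the claim.\<close>

lemma muckenhoupt_1_Holder:
  fixes w :: "'a::euclidean_space \<Rightarrow> real"
  assumes mw: "muckenhoupt 1 w"
  obtains C where "0 < C"
    "\<And>R g J. \<lbrakk>0 < R; 0 < ball_weight w R; g \<in> borel_measurable lebesgue; \<And>x. 0 \<le> g x; 0 \<le> J;
       (\<integral>\<^sup>+x\<in>ball 0 R. ennreal (g x * w x) \<partial>lebesgue) \<le> ennreal J\<rbrakk>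
     \<Longrightarrow> (\<integral>\<^sup>+x\<in>ball 0 R. ennreal (g x) \<partial>lebesgue) \<le> ennreal (C * R ^ DIM('a) * (J / ball_weight w R))"
proof -
  note w = muckenhoupt_weight[OF mw]
  note [measurable] = weight_measurable[OF w]
  define \<beta> where "\<beta> = unit_ball_vol (real DIM('a))"
  have \<beta>: "0 < \<beta>" by (simp add: \<beta>_def)
  obtain C where C: "0 < C" and A: "\<And>x r. r > 0 \<Longrightarrow> average (ball x r) (\<lambda>z. ennreal (w z))
               \<le> ennreal C * essinf_on (ball x r) (\<lambda>z. ennreal (w z))"
    using mw by (auto simp: muckenhoupt_def)
  show ?thesis
  proof (rule that[of "2 * C * \<beta>"])
    show "0 < 2 * C * \<beta>" using C \<beta> by simp
    fix R J :: real and g :: "'a \<Rightarrow> real"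
    assume R: "0 < R" and W: "0 < ball_weight w R" and [measurable]: "g \<in> borel_measurable lebesgue"
      and g: "\<And>x. 0 \<le> g x" and J: "0 \<le> J" and int: "(\<integral>\<^sup>+x\<in>ball 0 R. ennreal (g x * w x) \<partial>lebesgue) \<le> ennreal J"
    define W where "W = ball_weight w R"
    define b where "b = \<beta> * R ^ DIM('a)"
    have b: "0 < b" using R \<beta> by (simp add: b_def)
    \<comment> \<open>Half of the lower bound that A_1 gives for the essential infimum. The factor 2
      makes e strictly smaller than the supremum in \<open>essinf_on\<close>, so an admissible c
      above e exists.\<close>
    define e where "e = W / (2 * b * C)"
    have e: "0 < e" using W b C by (simp add: e_def W_def)
    have ess: "ennreal (W / b) \<le> ennreal C * essinf_on (ball 0 R) (\<lambda>z. ennreal (w z))"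
      using A[OF R, of 0] average_weight[OF w R] by (simp add: W_def b_def \<beta>_def)
    have "ennreal e < essinf_on (ball 0 R) (\<lambda>z. ennreal (w z))"
    proof (rule ccontr)
      assume "\<not> ?thesis"
      then have "ennreal C * essinf_on (ball 0 R) (\<lambda>z. ennreal (w z)) \<le> ennreal C * ennreal e"
        by (intro mult_left_mono) auto
      then have "ennreal (W / b) \<le> ennreal (C * e)"
        using ess C e by (simp add: ennreal_mult)
      then have "W / b \<le> C * e" using C e by simp
      then show False using C b W by (simp add: e_def W_def field_simps)
    qed
    then obtain c where c: "AE x in lebesgue. x \<in> ball 0 R \<longrightarrow> c \<le> ennreal (w x)" "ennreal e < c"
      unfolding essinf_on_def less_Sup_iff by blast
    have "ennreal e * (\<integral>\<^sup>+x\<in>ball 0 R. ennreal (g x) \<partial>lebesgue) = (\<integral>\<^sup>+x\<in>ball 0 R. ennreal (g x * e) \<partial>lebesgue)"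
      using g e by (subst nn_integral_cmult[symmetric], measurable) (auto simp: ennreal_mult mult_ac)
    also have "\<dots> \<le> (\<integral>\<^sup>+x\<in>ball 0 R. ennreal (g x * w x) \<partial>lebesgue)"
    proof (rule nn_integral_mono_AE)
      show "AE x in lebesgue. ennreal (g x * e) * indicator (ball 0 R) x \<le> ennreal (g x * w x) * indicator (ball 0 R) x"
        using c(1)
      proof eventually_elim
        case (elim x)
        show ?case
        proof (cases "x \<in> ball 0 R")
          case True
          then have "ennreal e \<le> ennreal (w x)" using elim c(2) by auto
          then have "e \<le> w x" using e weight_nonneg[OF w, of x] by simp
          then show ?thesis using g[of x] by (auto intro!: mult_right_mono ennreal_leI mult_left_mono)
        qed auto
      qed
    qed
    also note int
    finally have "ennreal (1 / e) * (ennreal e * (\<integral>\<^sup>+x\<in>ball 0 R. ennreal (g x) \<partial>lebesgue)) \<le> ennreal (1 / e) * ennreal J"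
      by (intro mult_left_mono) auto
    moreover have "ennreal (1 / e) * ennreal e = 1" using e by (simp add: ennreal_mult[symmetric])
    moreover have "ennreal (1 / e) * ennreal J = ennreal (J / e)" using e J by (simp add: ennreal_mult[symmetric])
    moreover have "J / e = 2 * C * \<beta> * R ^ DIM('a) * (J / ball_weight w R)"
      using W C b by (simp add: e_def W_def b_def)
    ultimately show "(\<integral>\<^sup>+x\<in>ball 0 R. ennreal (g x) \<partial>lebesgue) \<le> ennreal (2 * C * \<beta> * R ^ DIM('a) * (J / ball_weight w R))"
      by (simp add: mult.assoc[symmetric])
  qed
qed

text \<open>Write g as (g^\<xi> w)^(1/\<xi>) times (w^(-1/(\<xi>-1)))^(1-1/\<xi>) and use Hoelder's
  inequality; the A_\<xi> condition, solved for the average of the dual weight, bounds the second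
  integral.\<close>

lemma muckenhoupt_gt_1_Holder:
  fixes w :: "'a::euclidean_space \<Rightarrow> real"
  assumes mw: "muckenhoupt \<xi> w" and \<xi>: "1 < \<xi>"
  obtains C where "0 < C"
    "\<And>R g J. \<lbrakk>0 < R; 0 < ball_weight w R; g \<in> borel_measurable lebesgue; \<And>x. 0 \<le> g x; 0 \<le> J;
       (\<integral>\<^sup>+x\<in>ball 0 R. ennreal (g x powr \<xi> * w x) \<partial>lebesgue) \<le> ennreal J\<rbrakk>
     \<Longrightarrow> (\<integral>\<^sup>+x\<in>ball 0 R. ennreal (g x) \<partial>lebesgue)
           \<le> ennreal (C * R ^ DIM('a) * (J / ball_weight w R) powr (1 / \<xi>))"
proof -
  note w = muckenhoupt_weight[OF mw]
  note [measurable] = weight_measurable[OF w]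
  define \<beta> where "\<beta> = unit_ball_vol (real DIM('a))"
  have \<beta>: "0 < \<beta>" by (simp add: \<beta>_def)
  obtain C where C: "0 < C" and A: "\<And>x r. r > 0 \<Longrightarrow> average (ball x r) (\<lambda>z. ennreal (w z))
               * epowr (average (ball x r) (\<lambda>z. epowr (ennreal (w z)) (- 1 / (\<xi> - 1)))) (\<xi> - 1)
               \<le> ennreal C"
    using mw \<xi> by (auto simp: muckenhoupt_def)
  show ?thesis
  proof (rule that[of "C powr (1 / \<xi>) * \<beta>"])
    show "0 < C powr (1 / \<xi>) * \<beta>" using C \<beta> by simp
    fix R J :: real and g :: "'a \<Rightarrow> real"
    assume R: "0 < R" and W: "0 < ball_weight w R" and [measurable]: "g \<in> borel_measurable lebesgue"
      and g: "\<And>x. 0 \<le> g x" and J: "0 \<le> J"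
      and int: "(\<integral>\<^sup>+x\<in>ball 0 R. ennreal (g x powr \<xi> * w x) \<partial>lebesgue) \<le> ennreal J"
    define W where "W = ball_weight w R"
    have W: "0 < W" using W by (simp add: W_def)
    define b where "b = \<beta> * R ^ DIM('a)"
    have b: "0 < b" using R \<beta> by (simp add: b_def)
    define S where "S = average (ball 0 R) (\<lambda>z. epowr (ennreal (w z)) (- 1 / (\<xi> - 1)))"
    have AS: "ennreal (W / b) * epowr S (\<xi> - 1) \<le> ennreal C"
      using A[OF R, of 0] average_weight[OF w R] by (simp add: W_def b_def \<beta>_def S_def)
    \<comment> \<open>The average of w over this ball is positive, so an infinite dual average would
      make the Muckenhoupt product infinite.\<close>
    have "S \<noteq> top"
    proof
      assume "S = top"
      then have "epowr S (\<xi> - 1) = top" using \<xi> by (simp add: epowr_def)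
      then show False using AS W b by (simp add: ennreal_mult_top top_unique)
    qed
    then obtain s where s: "0 \<le> s" "S = ennreal s" by (cases S) auto
    have "W / b * s powr (\<xi> - 1) \<le> C"
      using AS s \<xi> W b C by (simp add: epowr_ennreal_pos ennreal_mult[symmetric])
    then have "s powr (\<xi> - 1) \<le> C * b / W"
      using W b by (simp add: field_simps)
    then have "(s powr (\<xi> - 1)) powr (1 / (\<xi> - 1)) \<le> (C * b / W) powr (1 / (\<xi> - 1))"
      using \<xi> by (intro powr_mono2) auto
    then have sle: "s \<le> (C * b / W) powr (1 / (\<xi> - 1))"
      using \<xi> s(1) by (simp add: powr_powr)
    have IS: "(\<integral>\<^sup>+x\<in>ball 0 R. epowr (ennreal (w x)) (- 1 / (\<xi> - 1)) \<partial>lebesgue) \<le> ennreal (b * s)"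
      using average_ball_le_imp[OF R, of 0 "\<lambda>z. epowr (ennreal (w z)) (- 1 / (\<xi> - 1))" s] s b
      by (simp add: S_def b_def \<beta>_def ennreal_mult)
    \<comment> \<open>\<open>epowr\<close> sends 0 to \<open>top\<close> under a negative exponent.
      Finiteness of the dual integral thus forces w > 0 almost everywhere on the ball, without which
      g could not be factored.\<close>
    have "AE x in lebesgue. epowr (ennreal (w x)) (- 1 / (\<xi> - 1)) * indicator (ball 0 R) x \<noteq> \<infinity>"
    proof (rule nn_integral_PInf_AE)
      show "(\<lambda>x. epowr (ennreal (w x)) (- 1 / (\<xi> - 1)) * indicator (ball 0 R) x) \<in> borel_measurable lebesgue"
        by measurable
    qed (use IS in \<open>auto simp: top_unique\<close>)
    then have wpos: "AE x in lebesgue. x \<in> ball 0 R \<longrightarrow> 0 < w x"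
    proof eventually_elim
      case (elim x)
      show ?case
      proof
        assume "x \<in> ball 0 R"
        then show "0 < w x"
          using elim \<xi> weight_nonneg[OF w, of x] by (cases "w x = 0") (auto simp: epowr_def field_simps)
      qed
    qed
    define F where "F x = g x powr \<xi> * w x * indicator (ball 0 R) x" for x
    define G where "G x = w x powr (- 1 / (\<xi> - 1)) * indicator (ball 0 R) x" for x
    have "(\<integral>\<^sup>+x\<in>ball 0 R. ennreal (g x) \<partial>lebesgue) = (\<integral>\<^sup>+x. ennreal (F x powr (1 / \<xi>) * G x powr (1 - 1 / \<xi>)) \<partial>lebesgue)"
    proof (rule nn_integral_cong_AE)
      show "AE x in lebesgue. ennreal (g x) * indicator (ball 0 R) x = ennreal (F x powr (1 / \<xi>) * G x powr (1 - 1 / \<xi>))"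
        using wpos
      proof eventually_elim
        case (elim x)
        show ?case
        proof (cases "x \<in> ball 0 R")
          case True
          then have wx: "0 < w x" using elim by auto
          have "F x powr (1 / \<xi>) * G x powr (1 - 1 / \<xi>)
              = g x * (w x powr (1 / \<xi>) * w x powr (- 1 / (\<xi> - 1) * (1 - 1 / \<xi>)))"
            using True wx \<xi> g[of x] by (simp add: F_def G_def powr_mult powr_powr)
          also have "- 1 / (\<xi> - 1) * (1 - 1 / \<xi>) = - (1 / \<xi>)" using \<xi> by (simp add: field_simps)
          also have "w x powr (1 / \<xi>) * w x powr (- (1 / \<xi>)) = 1" using wx by (simp add: powr_add[symmetric])
          finally show ?thesis using True by simp
        qed (auto simp: F_def)
      qed
    qed
    also have "\<dots> \<le> ennreal (J powr (1 / \<xi>) * (b * s) powr (1 - 1 / \<xi>))"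
    proof (rule nn_integral_Holder2)
      show "(\<integral>\<^sup>+x. ennreal (F x) \<partial>lebesgue) \<le> ennreal J"
      proof -
        have "ennreal (F x) = ennreal (g x powr \<xi> * w x) * indicator (ball 0 R) x" for x
          by (simp add: F_def indicator_def)
        then show ?thesis using int by (simp only:)
      qed
      have "(\<integral>\<^sup>+x. ennreal (G x) \<partial>lebesgue) \<le> (\<integral>\<^sup>+x\<in>ball 0 R. epowr (ennreal (w x)) (- 1 / (\<xi> - 1)) \<partial>lebesgue)"
      proof (rule nn_integral_mono)
        fix x show "ennreal (G x) \<le> epowr (ennreal (w x)) (- 1 / (\<xi> - 1)) * indicator (ball 0 R) x"
          using weight_nonneg[OF w, of x] epowr_ennreal[of "w x" "- 1 / (\<xi> - 1)"]
          by (cases "w x = 0") (auto simp: G_def indicator_def)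
      qed
      with IS show "(\<integral>\<^sup>+x. ennreal (G x) \<partial>lebesgue) \<le> ennreal (b * s)" by (rule order_trans[rotated])
    qed (use \<xi> J b s weight_nonneg[OF w] in \<open>auto simp: F_def[abs_def] G_def[abs_def]\<close>)
    also have "J powr (1 / \<xi>) * (b * s) powr (1 - 1 / \<xi>) \<le> J powr (1 / \<xi>) * (b * (C * b / W) powr (1 / (\<xi> - 1))) powr (1 - 1 / \<xi>)"
      using \<xi> b s sle by (intro mult_left_mono powr_mono2) auto
    also have "(b * (C * b / W) powr (1 / (\<xi> - 1))) powr (1 - 1 / \<xi>) = b powr (1 - 1 / \<xi>) * (C * b / W) powr (1 / (\<xi> - 1) * (1 - 1 / \<xi>))"
      using b C W by (simp add: powr_mult powr_powr)
    \<comment> \<open>With this exponent the two powers of the volume b recombine to b itself, the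
      source of R ^ DIM('a) in the claim.\<close>
    also have "1 / (\<xi> - 1) * (1 - 1 / \<xi>) = 1 / \<xi>" using \<xi> by (simp add: field_simps)
    also have "b powr (1 - 1 / \<xi>) * (C * b / W) powr (1 / \<xi>) = (b powr (1 - 1 / \<xi>) * b powr (1 / \<xi>)) * C powr (1 / \<xi>) / W powr (1 / \<xi>)"
      using b C W by (simp add: powr_mult powr_divide)
    also have "b powr (1 - 1 / \<xi>) * b powr (1 / \<xi>) = b" using b by (simp add: powr_add[symmetric])
    also have "J powr (1 / \<xi>) * (b * C powr (1 / \<xi>) / W powr (1 / \<xi>)) = C powr (1 / \<xi>) * \<beta> * R ^ DIM('a) * (J / W) powr (1 / \<xi>)"
      using J W by (simp add: powr_divide b_def)
    finally show "(\<integral>\<^sup>+x\<in>ball 0 R. ennreal (g x) \<partial>lebesgue)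
        \<le> ennreal (C powr (1 / \<xi>) * \<beta> * R ^ DIM('a) * (J / ball_weight w R) powr (1 / \<xi>))"
      by (simp add: W_def ennreal_leI)
  qed
qed

text \<open>The form in which the Muckenhoupt condition is applied from here on: indicators of
  smaller balls yield doubling, indicators of weightless sets yield positivity, and powers of Morrey
  functions get their weight back.\<close>

lemma muckenhoupt_Holder:
  fixes w :: "'a::euclidean_space \<Rightarrow> real"
  assumes mw: "muckenhoupt \<xi> w" and \<xi>: "1 \<le> \<xi>"
  obtains C where "0 < C"
    "\<And>R g J. \<lbrakk>0 < R; 0 < ball_weight w R; g \<in> borel_measurable lebesgue; \<And>x. 0 \<le> g x; 0 \<le> J;
       (\<integral>\<^sup>+x\<in>ball 0 R. ennreal (g x powr \<xi> * w x) \<partial>lebesgue) \<le> ennreal J\<rbrakk>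
     \<Longrightarrow> (\<integral>\<^sup>+x\<in>ball 0 R. ennreal (g x) \<partial>lebesgue)
           \<le> ennreal (C * R ^ DIM('a) * (J / ball_weight w R) powr (1 / \<xi>))"
proof (cases "\<xi> = 1")
  case True
  with mw have "muckenhoupt 1 w" by simp
  then obtain C where "0 < C" "\<And>R g J. \<lbrakk>0 < R; 0 < ball_weight w R; g \<in> borel_measurable lebesgue; \<And>x. 0 \<le> g x; 0 \<le> J;
       (\<integral>\<^sup>+x\<in>ball 0 R. ennreal (g x * w x) \<partial>lebesgue) \<le> ennreal J\<rbrakk>
     \<Longrightarrow> (\<integral>\<^sup>+x\<in>ball 0 R. ennreal (g x) \<partial>lebesgue) \<le> ennreal (C * R ^ DIM('a) * (J / ball_weight w R))"
    by (rule muckenhoupt_1_Holder) blast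
  with True show ?thesis by (intro that[of C]) auto
next
  case False
  with \<xi> have "1 < \<xi>" by simp
  then show ?thesis using muckenhoupt_gt_1_Holder[OF mw, of thesis] that by blast
qed

section \<open>Positivity of Muckenhoupt weights with finite critical index\<close>

text \<open>A vanishing weight satisfies the reverse Hoelder inequality for every exponent. Hence a
  finite critical index excludes the zero weight, which \<open>muckenhoupt\<close> admits.\<close>

lemma AE_zero_critical_index:
  fixes w :: "'a::euclidean_space \<Rightarrow> real"
  assumes "AE x in lebesgue. w x = 0"
  shows "critical_index w = \<infinity>"
proof -
  have "reverse_holder r w" if "1 < r" for r
  proof -
    have "average (ball x \<rho>) (\<lambda>z. epowr (ennreal (w z)) r) = 0" for x \<rho>
    proof -
      have "(\<integral>\<^sup>+z\<in>ball x \<rho>. epowr (ennreal (w z)) r \<partial>lebesgue) = (\<integral>\<^sup>+z. 0 \<partial>(lebesgue :: 'a measure))"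
      proof (rule nn_integral_cong_AE)
        show "AE z in lebesgue. epowr (ennreal (w z)) r * indicator (ball x \<rho>) z = 0"
          using assms by eventually_elim (use that in \<open>auto simp: epowr_def\<close>)
      qed
      then show ?thesis by (simp add: average_def)
    qed
    then show ?thesis unfolding reverse_holder_def using that by (auto intro!: exI[of _ 1] simp: epowr_def)
  qed
  then have le: "ereal r \<le> critical_index w" if "1 < r" for r
    unfolding critical_index_def using that by (intro Sup_upper) auto
  show ?thesis
  proof (rule ereal_top)
    fix B :: real
    have "ereal B \<le> ereal (max 2 B)" by simp
    also have "\<dots> \<le> critical_index w" by (rule le) auto
    finally show "ereal B \<le> critical_index w" .
  qed
qed

text \<open>A weightless ball infects all larger ones: if a larger ball had positive weight,
  \<open>muckenhoupt_Holder\<close> for the indicator of the small ball with J = 0 would give the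
  small ball Lebesgue measure 0. So w would vanish almost everywhere, against the finite critical
  index.\<close>

lemma muckenhoupt_ball_weight_pos:
  fixes w :: "'a::euclidean_space \<Rightarrow> real"
  assumes mw: "muckenhoupt \<xi> w" and \<xi>: "1 \<le> \<xi>" and crit: "critical_index w \<noteq> \<infinity>" and R: "0 < R"
  shows "0 < ball_weight w R"
proof (rule ccontr)
  assume "\<not> 0 < ball_weight w R"
  then have "ball_weight w R = 0" by (simp add: ball_weight_def less_le)
  note w = muckenhoupt_weight[OF mw]
  note [measurable] = weight_measurable[OF w]
  obtain C where "0 < C" and C:
    "\<And>R g J. \<lbrakk>0 < R; 0 < ball_weight w R; g \<in> borel_measurable lebesgue; \<And>x. 0 \<le> g x; 0 \<le> J;
       (\<integral>\<^sup>+x\<in>ball 0 R. ennreal (g x powr \<xi> * w x) \<partial>lebesgue) \<le> ennreal J\<rbrakk>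
     \<Longrightarrow> (\<integral>\<^sup>+x\<in>ball 0 R. ennreal (g x) \<partial>lebesgue)
           \<le> ennreal (C * R ^ DIM('a) * (J / ball_weight w R) powr (1 / \<xi>))"
    using muckenhoupt_Holder[OF mw \<xi>] by blast
  have "ball_weight w \<rho> = 0" if \<rho>: "R \<le> \<rho>" for \<rho>
  proof (rule ccontr)
    assume "ball_weight w \<rho> \<noteq> 0"
    then have pos: "0 < ball_weight w \<rho>" by (simp add: ball_weight_def less_le)
    have "(\<integral>\<^sup>+x\<in>ball 0 \<rho>. ennreal (indicator (ball (0::'a) R) x) \<partial>lebesgue) \<le> ennreal (C * \<rho> ^ DIM('a) * (0 / ball_weight w \<rho>) powr (1 / \<xi>))"
    proof (rule C)
      have "(\<integral>\<^sup>+x\<in>ball 0 \<rho>. ennreal (indicator (ball 0 R) x powr \<xi> * w x) \<partial>lebesgue) = weight_measure w (ball 0 R)"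
        unfolding weight_measure_def by (intro nn_integral_cong) (use \<rho> in \<open>auto simp: indicator_def\<close>)
      then show "(\<integral>\<^sup>+x\<in>ball 0 \<rho>. ennreal (indicator (ball 0 R) x powr \<xi> * w x) \<partial>lebesgue) \<le> ennreal 0"
        by (simp add: weight_measure_eq_ball_weight[OF w] \<open>ball_weight w R = 0\<close>)
      show "indicat_real (ball (0::'a) R) \<in> borel_measurable lebesgue" by measurable
    qed (use R \<rho> pos in auto)
    moreover have "(\<integral>\<^sup>+x\<in>ball 0 \<rho>. ennreal (indicator (ball (0::'a) R) x) \<partial>lebesgue) = emeasure lebesgue (ball (0::'a) R)"
    proof -
      have "(\<integral>\<^sup>+x\<in>ball 0 \<rho>. ennreal (indicator (ball (0::'a) R) x) \<partial>lebesgue) = (\<integral>\<^sup>+x. indicator (ball (0::'a) R) x \<partial>lebesgue)"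
        using \<rho> by (intro nn_integral_cong) (auto simp: indicator_def)
      then show ?thesis by (subst (asm) nn_integral_indicator) auto
    qed
    ultimately show False using R unit_ball_vol_pos[of "real DIM('a)"] by (auto simp: emeasure_ball)
  qed
  then have "AE x in lebesgue. x \<in> ball 0 \<rho> \<longrightarrow> w x = 0" if \<rho>: "R \<le> \<rho>" for \<rho>
  proof -
    have "(\<integral>\<^sup>+x\<in>ball 0 \<rho>. ennreal (w x) \<partial>lebesgue) = 0"
      using weight_measure_eq_ball_weight[OF w, of \<rho>] \<open>\<And>\<rho>. R \<le> \<rho> \<Longrightarrow> ball_weight w \<rho> = 0\<close>[OF \<rho>]
      by (simp add: weight_measure_def)
    then have "AE x in lebesgue. ennreal (w x) * indicator (ball 0 \<rho>) x = 0"
      by (subst (asm) nn_integral_0_iff_AE) auto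
    then show ?thesis
    proof eventually_elim
      case (elim x)
      then show ?case using weight_nonneg[OF w, of x] by (cases "x \<in> ball 0 \<rho>") auto
    qed
  qed
  then have "AE x in lebesgue. \<forall>k::nat. x \<in> ball 0 (R + real k) \<longrightarrow> w x = 0"
    by (subst AE_all_countable) auto
  then have "AE x in lebesgue. w x = 0"
  proof eventually_elim
    case (elim x)
    obtain k :: nat where "norm x < real k" using reals_Archimedean2 by blast
    then have "x \<in> ball 0 (R + real k)" using R by simp
    then show ?case using elim by blast
  qed
  then show False using AE_zero_critical_index crit by blast
qed

text \<open>Test \<open>muckenhoupt_Holder\<close> with the indicator of the zero set of w, where J
  = 0 is admissible. This later turns statements valid almost everywhere for w dx into statements
  for Lebesgue measure.\<close>

lemma muckenhoupt_AE_pos: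
  fixes w :: "'a::euclidean_space \<Rightarrow> real"
  assumes mw: "muckenhoupt \<xi> w" and \<xi>: "1 \<le> \<xi>" and crit: "critical_index w \<noteq> \<infinity>"
  shows "AE x in lebesgue. 0 < w x"
proof -
  note w = muckenhoupt_weight[OF mw]
  note [measurable] = weight_measurable[OF w]
  obtain C where "0 < C" and C:
    "\<And>R g J. \<lbrakk>0 < R; 0 < ball_weight w R; g \<in> borel_measurable lebesgue; \<And>x. 0 \<le> g x; 0 \<le> J;
       (\<integral>\<^sup>+x\<in>ball 0 R. ennreal (g x powr \<xi> * w x) \<partial>lebesgue) \<le> ennreal J\<rbrakk>
     \<Longrightarrow> (\<integral>\<^sup>+x\<in>ball 0 R. ennreal (g x) \<partial>lebesgue)
           \<le> ennreal (C * R ^ DIM('a) * (J / ball_weight w R) powr (1 / \<xi>))"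
    using muckenhoupt_Holder[OF mw \<xi>] by blast
  have "AE x in lebesgue. x \<in> ball 0 (1 + real k) \<longrightarrow> 0 < w x" for k :: nat
  proof -
    let ?R = "1 + real k"
    define g where "g x = (if w x = 0 then 1 else 0 :: real)" for x
    have [measurable]: "g \<in> borel_measurable lebesgue" unfolding g_def by measurable
    have "(\<integral>\<^sup>+x\<in>ball 0 ?R. ennreal (g x) \<partial>lebesgue) \<le> ennreal (C * ?R ^ DIM('a) * (0 / ball_weight w ?R) powr (1 / \<xi>))"
    proof (rule C)
      have "(\<lambda>x. ennreal (g x powr \<xi> * w x) * indicator (ball 0 ?R) x) = (\<lambda>_. 0)" by (auto simp: fun_eq_iff g_def)
      then show "(\<integral>\<^sup>+x\<in>ball 0 ?R. ennreal (g x powr \<xi> * w x) \<partial>lebesgue) \<le> ennreal 0" by simp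
    qed (auto intro!: muckenhoupt_ball_weight_pos[OF mw \<xi> crit] simp: g_def[of x for x])
    then have "AE x in lebesgue. ennreal (g x) * indicator (ball 0 ?R) x = 0"
      by (subst nn_integral_0_iff_AE[symmetric], measurable)
    then show ?thesis
    proof eventually_elim
      case (elim x)
      then show ?case using weight_nonneg[OF w, of x] by (cases "x \<in> ball 0 ?R"; cases "w x = 0") (auto simp: g_def)
    qed
  qed
  then have "AE x in lebesgue. \<forall>k::nat. x \<in> ball 0 (1 + real k) \<longrightarrow> 0 < w x"
    by (subst AE_all_countable) auto
  then show ?thesis
  proof eventually_elim
    case (elim x)
    obtain k :: nat where "norm x < real k" using reals_Archimedean2 by blast
    then have "x \<in> ball 0 (1 + real k)" by simp
    then show ?case using elim by blast
  qed
qed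

section \<open>Reverse Hoelder inequality and growth of the weights of balls\<close>

text \<open>Being below the supremum only yields some exponent s > r with the reverse Hoelder
  property; Hoelder's inequality on the ball passes from s down to r.\<close>

lemma critical_index_reverse_Holder:
  fixes w :: "'a::euclidean_space \<Rightarrow> real"
  assumes w: "weight w" and r: "1 < r" and crit: "ereal r < critical_index w"
  obtains C where "0 < C"
    "\<And>R. 0 < R \<Longrightarrow> (\<integral>\<^sup>+x\<in>ball 0 R. ennreal (w x powr r) \<partial>lebesgue)
       \<le> ennreal (C * R ^ DIM('a) * (ball_weight w R / R ^ DIM('a)) powr r)"
proof -
  note [measurable] = weight_measurable[OF w]
  define \<beta> where "\<beta> = unit_ball_vol (real DIM('a))"
  have \<beta>: "0 < \<beta>" by (simp add: \<beta>_def)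
  obtain s where s: "r < s" "reverse_holder s w"
    using crit unfolding critical_index_def less_Sup_iff by auto
  then obtain C where C: "0 < C" and A: "\<And>x \<rho>. \<rho> > 0 \<Longrightarrow>
        epowr (average (ball x \<rho>) (\<lambda>z. epowr (ennreal (w z)) s)) (1 / s)
          \<le> ennreal C * average (ball x \<rho>) (\<lambda>z. ennreal (w z))"
    unfolding reverse_holder_def by blast
  show ?thesis
  \<comment> \<open>Averages divide by the volume \<beta> * R ^ DIM('a), the claim only by R ^
    DIM('a); the powers of \<beta> go into the constant.\<close>
  proof (rule that[of "C powr r * \<beta> / \<beta> powr r"])
    show "0 < C powr r * \<beta> / \<beta> powr r" using C \<beta> by simp
    fix R :: real assume R: "0 < R"
    define W where "W = ball_weight w R"
    have W: "0 \<le> W" by (simp add: W_def)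
    define b where "b = \<beta> * R ^ DIM('a)"
    have b: "0 < b" using R \<beta> by (simp add: b_def)
    define S where "S = average (ball 0 R) (\<lambda>z. epowr (ennreal (w z)) s)"
    have "epowr S (1 / s) \<le> ennreal C * ennreal (W / b)"
      using A[OF R, of 0] average_weight[OF w R] by (simp add: W_def b_def \<beta>_def S_def)
    then have AS: "epowr S (1 / s) \<le> ennreal (C * W / b)"
      using C W b by (simp add: ennreal_mult[symmetric])
    have "S \<noteq> top"
    proof
      assume "S = top"
      then have "epowr S (1 / s) = top" using s r by (simp add: epowr_def)
      then show False using AS by (simp add: top_unique)
    qed
    then obtain t where t: "0 \<le> t" "S = ennreal t" by (cases S) auto
    have "t powr (1 / s) \<le> C * W / b"
      using AS t s r W b C by (simp add: epowr_ennreal_pos)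
    then have "(t powr (1 / s)) powr s \<le> (C * W / b) powr s"
      using s r by (intro powr_mono2) auto
    then have tle: "t \<le> (C * W / b) powr s"
      using s r t(1) by (simp add: powr_powr)
    have eq: "ennreal (w x powr s * indicator (ball 0 R) x) = epowr (ennreal (w x)) s * indicator (ball 0 R) x" for x
      using weight_nonneg[OF w, of x] s r by (simp add: epowr_ennreal_pos indicator_def)
    have IS: "(\<integral>\<^sup>+x. ennreal (w x powr s * indicator (ball 0 R) x) \<partial>lebesgue) \<le> ennreal (b * t)"
      unfolding eq
      using average_ball_le_imp[OF R, of 0 "\<lambda>z. epowr (ennreal (w z)) s" t] t b
      by (simp add: S_def b_def \<beta>_def ennreal_mult)
    have "(\<integral>\<^sup>+x\<in>ball 0 R. ennreal (w x powr r) \<partial>lebesgue)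
      = (\<integral>\<^sup>+x. ennreal ((w x powr s * indicator (ball 0 R) x) powr (r / s) * indicator (ball 0 R) x powr (1 - r / s)) \<partial>lebesgue)"
      using s r by (intro nn_integral_cong) (auto simp: powr_powr indicator_def)
    also have "\<dots> \<le> ennreal ((b * t) powr (r / s) * b powr (1 - r / s))"
    proof (rule nn_integral_Holder2)
      have "(\<integral>\<^sup>+x. ennreal (indicator (ball (0::'a) R) x) \<partial>lebesgue) = (\<integral>\<^sup>+x. indicator (ball (0::'a) R) x \<partial>lebesgue)"
        by (intro nn_integral_cong) (auto simp: indicator_def)
      also have "\<dots> = ennreal b"
        using R by (subst nn_integral_indicator) (auto simp: emeasure_ball b_def \<beta>_def)
      finally show "(\<integral>\<^sup>+x. ennreal (indicator (ball (0::'a) R) x) \<partial>lebesgue) \<le> ennreal b" by simp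
      show "indicat_real (ball (0::'a) R) \<in> borel_measurable lebesgue" by measurable
      show "(\<lambda>x. w x powr s * indicat_real (ball 0 R) x) \<in> borel_measurable lebesgue" by measurable
    qed (use s r t b IS in auto)
    also have "(b * t) powr (r / s) * b powr (1 - r / s) = t powr (r / s) * (b powr (r / s) * b powr (1 - r / s))"
      using b t by (simp add: powr_mult)
    also have "b powr (r / s) * b powr (1 - r / s) = b" using b by (simp add: powr_add[symmetric])
    also have "t powr (r / s) * b \<le> ((C * W / b) powr s) powr (r / s) * b"
      using b s r t tle by (intro mult_right_mono powr_mono2) auto
    also have "((C * W / b) powr s) powr (r / s) = (C * W / b) powr r"
      using s r by (simp add: powr_powr)
    also have "(C * W / b) powr r * b = C powr r * \<beta> / \<beta> powr r * R ^ DIM('a) * (ball_weight w R / R ^ DIM('a)) powr r"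
      using C W b \<beta> R by (simp add: b_def W_def powr_mult powr_divide)
    finally show "(\<integral>\<^sup>+x\<in>ball 0 R. ennreal (w x powr r) \<partial>lebesgue)
       \<le> ennreal (C powr r * \<beta> / \<beta> powr r * R ^ DIM('a) * (ball_weight w R / R ^ DIM('a)) powr r)"
      by (simp add: ennreal_leI)
  qed
qed

text \<open>The indicator of the smaller ball in \<open>muckenhoupt_Holder\<close> bounds the ratio
  of volumes by the ratio of weights to the power 1 / \<xi>; raise this to the power \<xi>.\<close>

lemma muckenhoupt_doubling:
  fixes w :: "'a::euclidean_space \<Rightarrow> real"
  assumes mw: "muckenhoupt \<xi> w" and \<xi>: "1 \<le> \<xi>" and crit: "critical_index w \<noteq> \<infinity>"
  obtains C where "0 < C"
    "\<And>\<rho> R. \<lbrakk>0 < \<rho>; \<rho> \<le> R\<rbrakk> \<Longrightarrow> ball_weight w R \<le> C * (R / \<rho>) powr (real DIM('a) * \<xi>) * ball_weight w \<rho>"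
proof -
  note w = muckenhoupt_weight[OF mw]
  note pos = muckenhoupt_ball_weight_pos[OF mw \<xi> crit]
  define \<beta> where "\<beta> = unit_ball_vol (real DIM('a))"
  have \<beta>: "0 < \<beta>" by (simp add: \<beta>_def)
  obtain C where C0: "0 < C" and C:
    "\<And>R g J. \<lbrakk>0 < R; 0 < ball_weight w R; g \<in> borel_measurable lebesgue; \<And>x. 0 \<le> g x; 0 \<le> J;
       (\<integral>\<^sup>+x\<in>ball 0 R. ennreal (g x powr \<xi> * w x) \<partial>lebesgue) \<le> ennreal J\<rbrakk>
     \<Longrightarrow> (\<integral>\<^sup>+x\<in>ball 0 R. ennreal (g x) \<partial>lebesgue)
           \<le> ennreal (C * R ^ DIM('a) * (J / ball_weight w R) powr (1 / \<xi>))"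
    using muckenhoupt_Holder[OF mw \<xi>] by blast
  show ?thesis
  proof (rule that[of "(C / \<beta>) powr \<xi>"])
    show "0 < (C / \<beta>) powr \<xi>" using C0 \<beta> by simp
    fix \<rho> R :: real assume \<rho>: "0 < \<rho>" "\<rho> \<le> R"
    then have R: "0 < R" by simp
    have "(\<integral>\<^sup>+x\<in>ball 0 R. ennreal (indicator (ball (0::'a) \<rho>) x) \<partial>lebesgue)
       \<le> ennreal (C * R ^ DIM('a) * (ball_weight w \<rho> / ball_weight w R) powr (1 / \<xi>))"
    proof (rule C)
      have "(\<integral>\<^sup>+x\<in>ball 0 R. ennreal (indicator (ball 0 \<rho>) x powr \<xi> * w x) \<partial>lebesgue) = weight_measure w (ball 0 \<rho>)"
        unfolding weight_measure_def by (intro nn_integral_cong) (use \<rho> in \<open>auto simp: indicator_def\<close>)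
      then show "(\<integral>\<^sup>+x\<in>ball 0 R. ennreal (indicator (ball 0 \<rho>) x powr \<xi> * w x) \<partial>lebesgue) \<le> ennreal (ball_weight w \<rho>)"
        by (simp add: weight_measure_eq_ball_weight[OF w])
      show "indicat_real (ball (0::'a) \<rho>) \<in> borel_measurable lebesgue" by measurable
    qed (use R pos in auto)
    moreover have "(\<integral>\<^sup>+x\<in>ball 0 R. ennreal (indicator (ball (0::'a) \<rho>) x) \<partial>lebesgue) = ennreal (\<beta> * \<rho> ^ DIM('a))"
    proof -
      have "(\<integral>\<^sup>+x\<in>ball 0 R. ennreal (indicator (ball (0::'a) \<rho>) x) \<partial>lebesgue) = (\<integral>\<^sup>+x. indicator (ball (0::'a) \<rho>) x \<partial>lebesgue)"
        using \<rho> by (intro nn_integral_cong) (auto simp: indicator_def)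
      also have "\<dots> = ennreal (\<beta> * \<rho> ^ DIM('a))"
        using \<rho> by (subst nn_integral_indicator) (auto simp: emeasure_ball \<beta>_def)
      finally show ?thesis .
    qed
    ultimately have "\<beta> * \<rho> ^ DIM('a) \<le> C * R ^ DIM('a) * (ball_weight w \<rho> / ball_weight w R) powr (1 / \<xi>)"
      using C0 R by (simp add: ennreal_le_iff)
    then have "1 \<le> C / \<beta> * (R / \<rho>) ^ DIM('a) * (ball_weight w \<rho> / ball_weight w R) powr (1 / \<xi>)"
      using \<beta> \<rho> by (simp add: field_simps)
    then have "1 powr \<xi> \<le> (C / \<beta> * (R / \<rho>) powr real DIM('a) * (ball_weight w \<rho> / ball_weight w R) powr (1 / \<xi>)) powr \<xi>"
      using \<xi> R \<rho> by (intro powr_mono2) (auto simp: powr_realpow)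
    also have "\<dots> = (C / \<beta>) powr \<xi> * (R / \<rho>) powr (real DIM('a) * \<xi>) * (ball_weight w \<rho> / ball_weight w R)"
    proof -
      have "(a * b powr real DIM('a) * c powr (1 / \<xi>)) powr \<xi> = a powr \<xi> * b powr (real DIM('a) * \<xi>) * c"
        if "0 < a" "0 < b" "0 < c" for a b c :: real
        using that \<xi> by (simp add: powr_mult powr_powr)
      then show ?thesis using C0 \<beta> R \<rho> pos[of \<rho>] pos[of R] by (simp del: times_divide_eq_left times_divide_eq_right)
    qed
    finally show "ball_weight w R \<le> (C / \<beta>) powr \<xi> * (R / \<rho>) powr (real DIM('a) * \<xi>) * ball_weight w \<rho>"
      using pos[OF R] by (simp add: field_simps)
  qed
qed

text \<open>Hoelder's inequality on the small ball, with exponent \<delta> on w, leaves the volume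
  of the small ball to the power 1 - 1 / \<delta>; the integral of w^\<delta> is enlarged to the big
  ball, where the reverse Hoelder inequality applies.\<close>

lemma critical_index_reverse_doubling:
  fixes w :: "'a::euclidean_space \<Rightarrow> real"
  assumes w: "weight w" and \<delta>: "1 < \<delta>" and crit: "ereal \<delta> < critical_index w"
  obtains C where "0 < C"
    "\<And>\<rho> R. \<lbrakk>0 < \<rho>; \<rho> \<le> R\<rbrakk> \<Longrightarrow>
      ball_weight w \<rho> \<le> C * (\<rho> / R) powr (real DIM('a) * ((\<delta> - 1) / \<delta>)) * ball_weight w R"
proof -
  note [measurable] = weight_measurable[OF w]
  define \<beta> where "\<beta> = unit_ball_vol (real DIM('a))"
  have \<beta>: "0 < \<beta>" by (simp add: \<beta>_def)
  obtain C where C0: "0 < C" and C: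
    "\<And>R. 0 < R \<Longrightarrow> (\<integral>\<^sup>+x\<in>ball 0 R. ennreal (w x powr \<delta>) \<partial>lebesgue)
       \<le> ennreal (C * R ^ DIM('a) * (ball_weight w R / R ^ DIM('a)) powr \<delta>)"
    using critical_index_reverse_Holder[OF w \<delta> crit] by blast
  show ?thesis
  proof (rule that[of "C powr (1 / \<delta>) * \<beta> powr (1 - 1 / \<delta>)"])
    show "0 < C powr (1 / \<delta>) * \<beta> powr (1 - 1 / \<delta>)" using C0 \<beta> by simp
    fix \<rho> R :: real assume \<rho>: "0 < \<rho>" "\<rho> \<le> R"
    then have R: "0 < R" by simp
    define W where "W = ball_weight w R"
    have W: "0 \<le> W" by (simp add: W_def)
    define d where "d = real DIM('a)"
    have "ennreal (ball_weight w \<rho>) = (\<integral>\<^sup>+x\<in>ball 0 \<rho>. ennreal (w x) \<partial>lebesgue)"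
      using weight_measure_eq_ball_weight[OF w, of \<rho>] by (simp add: weight_measure_def)
    also have "\<dots> = (\<integral>\<^sup>+x. ennreal ((w x powr \<delta> * indicator (ball 0 R) x) powr (1 / \<delta>) * indicator (ball 0 \<rho>) x powr (1 - 1 / \<delta>)) \<partial>lebesgue)"
      using \<delta> \<rho> weight_nonneg[OF w] by (intro nn_integral_cong) (auto simp: powr_powr indicator_def)
    also have "\<dots> \<le> ennreal ((C * R ^ DIM('a) * (W / R ^ DIM('a)) powr \<delta>) powr (1 / \<delta>) * (\<beta> * \<rho> ^ DIM('a)) powr (1 - 1 / \<delta>))"
    proof (rule nn_integral_Holder2)
      have eq: "ennreal (w x powr \<delta> * indicator (ball 0 R) x) = ennreal (w x powr \<delta>) * indicator (ball 0 R) x" for x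
        by (simp add: indicator_def)
      show "(\<integral>\<^sup>+x. ennreal (w x powr \<delta> * indicator (ball 0 R) x) \<partial>lebesgue) \<le> ennreal (C * R ^ DIM('a) * (W / R ^ DIM('a)) powr \<delta>)"
        unfolding eq using C[OF R] by (simp add: W_def)
      have "(\<integral>\<^sup>+x. ennreal (indicator (ball (0::'a) \<rho>) x) \<partial>lebesgue) = (\<integral>\<^sup>+x. indicator (ball (0::'a) \<rho>) x \<partial>lebesgue)"
        by (intro nn_integral_cong) (auto simp: indicator_def)
      also have "\<dots> = ennreal (\<beta> * \<rho> ^ DIM('a))"
        using \<rho> by (subst nn_integral_indicator) (auto simp: emeasure_ball \<beta>_def)
      finally show "(\<integral>\<^sup>+x. ennreal (indicator (ball (0::'a) \<rho>) x) \<partial>lebesgue) \<le> ennreal (\<beta> * \<rho> ^ DIM('a))" by simp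
      show "indicat_real (ball (0::'a) \<rho>) \<in> borel_measurable lebesgue" by measurable
      show "(\<lambda>x. w x powr \<delta> * indicat_real (ball 0 R) x) \<in> borel_measurable lebesgue" by measurable
    qed (use \<delta> \<rho> C0 \<beta> R in auto)
    finally have "ball_weight w \<rho> \<le> (C * R ^ DIM('a) * (W / R ^ DIM('a)) powr \<delta>) powr (1 / \<delta>) * (\<beta> * \<rho> ^ DIM('a)) powr (1 - 1 / \<delta>)"
      by simp
    also have "\<dots> = (C * R powr d * (W / R powr d) powr \<delta>) powr (1 / \<delta>) * (\<beta> * \<rho> powr d) powr (1 - 1 / \<delta>)"
      using R \<rho> by (simp add: powr_realpow d_def)
    also have "\<dots> = C powr (1 / \<delta>) * \<beta> powr (1 - 1 / \<delta>) * (\<rho> powr (d * (1 - 1 / \<delta>)) * (R powr (d / \<delta>) / R powr d)) * W"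
      using C0 R W \<delta> \<beta> \<rho> by (simp add: powr_mult powr_powr)
    also have "R powr (d / \<delta>) / R powr d = 1 / R powr (d * (1 - 1 / \<delta>))"
      using R by (simp add: field_simps powr_add[symmetric])
    also have "\<rho> powr (d * (1 - 1 / \<delta>)) * (1 / R powr (d * (1 - 1 / \<delta>))) = (\<rho> / R) powr (d * ((\<delta> - 1) / \<delta>))"
      using R \<rho> \<delta> by (simp add: powr_divide diff_divide_distrib)
    finally show "ball_weight w \<rho> \<le> C powr (1 / \<delta>) * \<beta> powr (1 - 1 / \<delta>) * (\<rho> / R) powr (real DIM('a) * ((\<delta> - 1) / \<delta>)) * ball_weight w R"
      by (simp add: d_def W_def)
  qed
qed

section \<open>Estimates for a fixed value of the parameter\<close>

declare pred_ball_lebesgue[measurable del]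

lemma abs_det_matrix_inv:
  fixes A :: "real^'n^'n"
  assumes "det A \<noteq> 0"
  shows "\<bar>det (matrix_inv A)\<bar> = 1 / \<bar>det A\<bar>"
proof -
  have "A ** matrix_inv A = mat 1"
    using assms unfolding invertible_det_nz[symmetric] invertible_def matrix_inv_def
    by (rule someI2_ex) blast
  then have "det A * det (matrix_inv A) = 1" by (metis det_I det_mul)
  then have "\<bar>det A\<bar> * \<bar>det (matrix_inv A)\<bar> = 1" by (metis abs_mult abs_one)
  then show ?thesis using assms by (simp add: field_simps)
qed

lemma measurable_matrix_vector_mult_left[measurable]:
  fixes A :: "real^'n^'m"
  shows "(*v) A \<in> borel_measurable borel"
  by (intro borel_measurable_continuous_onI matrix_vector_mult_linear_continuous_on)

lemma nn_integral_linear_substitution: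
  fixes A :: "real^'n^'n" and g :: "real^'n \<Rightarrow> ennreal"
  assumes A: "det A \<noteq> 0" and [measurable]: "g \<in> borel_measurable borel"
  shows "(\<integral>\<^sup>+x. g (A *v x) \<partial>lborel) = ennreal \<bar>det (matrix_inv A)\<bar> * (\<integral>\<^sup>+x. g x \<partial>lborel)"
proof -
  have "(\<integral>\<^sup>+x. g x \<partial>lborel) = ennreal \<bar>det A\<bar> * (\<integral>\<^sup>+x. g (A *v x) \<partial>lborel)"
    by (subst lborel_linear_image[OF A]) (simp add: nn_integral_density nn_integral_distr nn_integral_cmult)
  moreover have "ennreal \<bar>det (matrix_inv A)\<bar> * ennreal \<bar>det A\<bar> = 1"
    using A by (simp add: abs_det_matrix_inv ennreal_mult[symmetric])
  ultimately show ?thesis by (simp add: mult.assoc[symmetric])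
qed

text \<open>One index of the integrand of \<open>C4\<close>, as a function of the matrix instead of
  y, so that measurability follows by composition. The three factors come from the substitution and
  the volume of the dilated ball, from v on the dilated ball, and from \<omega> on it.\<close>

definition kernel_factor ::
  "real \<Rightarrow> real \<Rightarrow> real \<Rightarrow> real \<Rightarrow> real \<Rightarrow> real \<Rightarrow> real^'n^'n \<Rightarrow> real" where
  "kernel_factor q l \<xi> \<eta> \<delta>1 \<delta>2 A =
     (let n = real CARD('n); a = norm A in
       (\<bar>det (matrix_inv A)\<bar> powr (\<xi> / q) * a powr (\<xi> * n / q))
       * (if a \<le> 1 then a powr (n * (l + 1 / q) * ((\<delta>2 - 1) / \<delta>2)) else a powr (n * \<eta> * (l + 1 / q)))
       * (if a \<le> 1 then a powr (- (\<xi> * n / q)) else a powr (- (n / q) * ((\<delta>1 - 1) / \<delta>1))))"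

lemma kernel_factor_nonneg: "0 \<le> kernel_factor q l \<xi> \<eta> \<delta>1 \<delta>2 A"
  by (simp add: kernel_factor_def Let_def)

text \<open>For a \<le> 1 the dilated ball is the smaller one: reverse doubling bounds its weight
  from above, doubling from below. For a > 1 the roles are exchanged. The first bound serves v, the
  second \<omega>.\<close>

lemma dilated_ball_weight_le:
  fixes w :: "real^'n \<Rightarrow> real"
  assumes mw: "muckenhoupt \<xi> w" and \<xi>: "1 \<le> \<xi>" and \<delta>: "1 < \<delta>" "ereal \<delta> < critical_index w"
    and crit: "critical_index w \<noteq> \<infinity>"
  obtains C where "0 < C"
    "\<And>a R. \<lbrakk>0 < a; 0 < R\<rbrakk> \<Longrightarrow> ball_weight w (a * R)
      \<le> C * (if a \<le> 1 then a powr (real CARD('n) * ((\<delta> - 1) / \<delta>)) else a powr (real CARD('n) * \<xi>)) * ball_weight w R"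
    "\<And>a R. \<lbrakk>0 < a; 0 < R\<rbrakk> \<Longrightarrow> ball_weight w R
      \<le> C * (if a \<le> 1 then a powr (- (real CARD('n) * \<xi>)) else a powr (- (real CARD('n) * ((\<delta> - 1) / \<delta>)))) * ball_weight w (a * R)"
proof -
  obtain C1 where C1: "0 < C1" and A: "\<And>\<rho> R. \<lbrakk>0 < \<rho>; \<rho> \<le> R\<rbrakk> \<Longrightarrow>
      ball_weight w R \<le> C1 * (R / \<rho>) powr (real CARD('n) * \<xi>) * ball_weight w \<rho>"
    using muckenhoupt_doubling[OF mw \<xi> crit] by auto
  obtain C2 where C2: "0 < C2" and B: "\<And>\<rho> R. \<lbrakk>0 < \<rho>; \<rho> \<le> R\<rbrakk> \<Longrightarrow>
      ball_weight w \<rho> \<le> C2 * (\<rho> / R) powr (real CARD('n) * ((\<delta> - 1) / \<delta>)) * ball_weight w R"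
    using critical_index_reverse_doubling[OF muckenhoupt_weight[OF mw] \<delta>] by auto
  define C where "C = max C1 C2"
  have C: "0 < C" "C1 \<le> C" "C2 \<le> C" using C1 by (auto simp: C_def)
  have A': "ball_weight w R \<le> C * (R / \<rho>) powr (real CARD('n) * \<xi>) * ball_weight w \<rho>" if "0 < \<rho>" "\<rho> \<le> R" for \<rho> R
    using C by (intro order_trans[OF A[OF that]] mult_right_mono) auto
  have B': "ball_weight w \<rho> \<le> C * (\<rho> / R) powr (real CARD('n) * ((\<delta> - 1) / \<delta>)) * ball_weight w R" if "0 < \<rho>" "\<rho> \<le> R" for \<rho> R
    using C by (intro order_trans[OF B[OF that]] mult_right_mono) auto
  show ?thesis
  proof (rule that[OF C(1)])
    fix a R :: real assume a: "0 < a" "0 < R"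
    show "ball_weight w (a * R)
      \<le> C * (if a \<le> 1 then a powr (real CARD('n) * ((\<delta> - 1) / \<delta>)) else a powr (real CARD('n) * \<xi>)) * ball_weight w R"
      using A'[of R "a * R"] B'[of "a * R" R] a by (auto simp: mult_le_cancel_right1)
    show "ball_weight w R
      \<le> C * (if a \<le> 1 then a powr (- (real CARD('n) * \<xi>)) else a powr (- (real CARD('n) * ((\<delta> - 1) / \<delta>)))) * ball_weight w (a * R)"
    proof (cases "a \<le> 1")
      case True
      then have "a * R \<le> R" using a by (simp add: mult_le_cancel_right1)
      then show ?thesis using True A'[of "a * R" R] a by (simp add: powr_divide powr_minus_divide)
    next
      case False
      then have "R \<le> a * R" using a by simp
      then show ?thesis using False B'[of R "a * R"] a by (simp add: powr_divide powr_minus_divide)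
    qed
  qed
qed

text \<open>The power q / \<xi> is the one whose \<xi>-th power is the power q of the Morrey norm,
  as \<open>muckenhoupt_Holder\<close> requires. The dilated ball may have any radius, so the Morrey
  bound is assumed for all \<rho>.\<close>

lemma nn_integral_dilated_factor_le:
  fixes v w :: "real^'n \<Rightarrow> real"
  assumes mw: "muckenhoupt \<xi> w" and \<xi>: "1 \<le> \<xi>" and mv: "muckenhoupt \<eta> v" and \<eta>: "1 \<le> \<eta>"
    and crit: "critical_index w \<noteq> \<infinity>" "critical_index v \<noteq> \<infinity>"
    and \<delta>1: "1 < \<delta>1" "ereal \<delta>1 < critical_index w" and \<delta>2: "1 < \<delta>2" "ereal \<delta>2 < critical_index v"
    and q: "0 < q" and l: "0 \<le> l + 1 / q"
  obtains C where "0 < C"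
    "\<And>A R f N. \<lbrakk>det A \<noteq> 0; 0 < R; f \<in> borel_measurable borel; 0 \<le> N;
      \<And>\<rho>. 0 < \<rho> \<Longrightarrow> (\<integral>\<^sup>+x\<in>ball 0 \<rho>. ennreal (norm (f x) powr q * w x) \<partial>lebesgue)
        \<le> ennreal ((N * ball_weight v \<rho> powr (l + 1 / q)) powr q)\<rbrakk>
     \<Longrightarrow> (\<integral>\<^sup>+x\<in>ball 0 R. ennreal (norm (f (A *v x) :: complex) powr (q / \<xi>)) \<partial>lborel)
        \<le> ennreal ((C * R powr (real CARD('n) * \<xi> / q) * (kernel_factor q l \<xi> \<eta> \<delta>1 \<delta>2 A * N)
            * ball_weight v R powr (l + 1 / q) / ball_weight w R powr (1 / q)) powr (q / \<xi>))"
proof -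
  note Wpos = muckenhoupt_ball_weight_pos[OF mw \<xi> crit(1)]
  note Vpos = muckenhoupt_ball_weight_pos[OF mv \<eta> crit(2)]
  define n where "n = real CARD('n)"
  have dim: "DIM(real^'n) = CARD('n)" by simp
  obtain C1 where C1: "0 < C1" and H:
    "\<And>R g J. \<lbrakk>0 < R; 0 < ball_weight w R; g \<in> borel_measurable lebesgue; \<And>x. 0 \<le> g x; 0 \<le> J;
       (\<integral>\<^sup>+x\<in>ball 0 R. ennreal (g x powr \<xi> * w x) \<partial>lebesgue) \<le> ennreal J\<rbrakk>
     \<Longrightarrow> (\<integral>\<^sup>+x\<in>ball 0 R. ennreal (g x) \<partial>lebesgue)
           \<le> ennreal (C1 * R ^ DIM(real^'n) * (J / ball_weight w R) powr (1 / \<xi>))"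
    using muckenhoupt_Holder[OF mw \<xi>] by blast
  obtain Cw where Cw: "0 < Cw" and WR: "\<And>a R. \<lbrakk>0 < a; 0 < R\<rbrakk> \<Longrightarrow> ball_weight w R
      \<le> Cw * (if a \<le> 1 then a powr (- (n * \<xi>)) else a powr (- (n * ((\<delta>1 - 1) / \<delta>1)))) * ball_weight w (a * R)"
    unfolding n_def using dilated_ball_weight_le[OF mw \<xi> \<delta>1 crit(1)] by metis
  obtain Cv where Cv: "0 < Cv" and VR: "\<And>a R. \<lbrakk>0 < a; 0 < R\<rbrakk> \<Longrightarrow> ball_weight v (a * R)
      \<le> Cv * (if a \<le> 1 then a powr (n * ((\<delta>2 - 1) / \<delta>2)) else a powr (n * \<eta>)) * ball_weight v R"
    unfolding n_def using dilated_ball_weight_le[OF mv \<eta> \<delta>2 crit(2)] by metis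
  define s where "s = l + 1 / q"
  have s: "0 \<le> s" using l by (simp add: s_def)
  show ?thesis
  proof (rule that[of "C1 powr (\<xi> / q) * Cv powr s * Cw powr (1 / q)"])
    show "0 < C1 powr (\<xi> / q) * Cv powr s * Cw powr (1 / q)" using C1 Cv Cw by simp
    fix A :: "real^'n^'n" and R N :: real and f :: "real^'n \<Rightarrow> complex"
    assume A: "det A \<noteq> 0" and R: "0 < R" and [measurable]: "f \<in> borel_measurable borel" and N: "0 \<le> N"
      and f: "\<And>\<rho>. 0 < \<rho> \<Longrightarrow> (\<integral>\<^sup>+x\<in>ball 0 \<rho>. ennreal (norm (f x) powr q * w x) \<partial>lebesgue)
        \<le> ennreal ((N * ball_weight v \<rho> powr (l + 1 / q)) powr q)"
    define a where "a = norm A"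
    have "A \<noteq> 0" using A det_0[where ?'n='n and ?'a=real] by auto
    then have a: "0 < a" by (simp add: a_def)
    define \<rho> where "\<rho> = a * R"
    have \<rho>: "0 < \<rho>" using a R by (simp add: \<rho>_def)
    have [measurable]: "ball (0::real^'n) \<rho> \<in> sets borel" by simp
    define d where "d = \<bar>det (matrix_inv A)\<bar>"
    have d: "0 < d" using A by (simp add: d_def abs_det_matrix_inv)
    define \<alpha> where "\<alpha> = (if a \<le> 1 then a powr (n * ((\<delta>2 - 1) / \<delta>2)) else a powr (n * \<eta>))"
    define \<gamma> where "\<gamma> = (if a \<le> 1 then a powr (- (n * \<xi>)) else a powr (- (n * ((\<delta>1 - 1) / \<delta>1))))"
    have \<alpha>: "0 < \<alpha>" and \<gamma>: "0 < \<gamma>" using a by (auto simp: \<alpha>_def \<gamma>_def)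
    have K: "kernel_factor q l \<xi> \<eta> \<delta>1 \<delta>2 A = d powr (\<xi> / q) * a powr (n * \<xi> / q) * \<alpha> powr s * \<gamma> powr (1 / q)"
      using a by (simp add: kernel_factor_def Let_def d_def a_def[symmetric] n_def[symmetric] \<alpha>_def \<gamma>_def s_def powr_powr mult_ac)
    define J where "J = (N * ball_weight v \<rho> powr s) powr q"
    have "(\<integral>\<^sup>+x\<in>ball 0 R. ennreal (norm (f (A *v x)) powr (q / \<xi>)) \<partial>lborel)
        \<le> (\<integral>\<^sup>+x. (ennreal (norm (f (A *v x)) powr (q / \<xi>)) * indicator (ball 0 \<rho>) (A *v x)) \<partial>lborel)"
    proof (rule nn_integral_mono)
      fix x :: "real^'n"
      show "ennreal (norm (f (A *v x)) powr (q / \<xi>)) * indicator (ball 0 R) x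
          \<le> ennreal (norm (f (A *v x)) powr (q / \<xi>)) * indicator (ball 0 \<rho>) (A *v x)"
      proof (cases "norm x < R")
        case True
        then have "a * norm x < \<rho>" using a by (simp add: \<rho>_def)
        then have "norm (A *v x) < \<rho>" using norm_matrix_vector_mult_le[of A x] by (simp add: a_def)
        then show ?thesis by (auto simp: indicator_def)
      qed auto
    qed
    also have "\<dots> = ennreal d * (\<integral>\<^sup>+x\<in>ball 0 \<rho>. ennreal (norm (f x) powr (q / \<xi>)) \<partial>lborel)"
      unfolding d_def by (rule nn_integral_linear_substitution[OF A]) measurable
    also have "(\<integral>\<^sup>+x\<in>ball 0 \<rho>. ennreal (norm (f x) powr (q / \<xi>)) \<partial>lborel)
        = (\<integral>\<^sup>+x\<in>ball 0 \<rho>. ennreal (norm (f x) powr (q / \<xi>)) \<partial>lebesgue)"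
      by (simp add: nn_integral_completion)
    also have "\<dots> \<le> ennreal (C1 * \<rho> ^ CARD('n) * (J / ball_weight w \<rho>) powr (1 / \<xi>))"
    proof (rule H[OF \<rho> Wpos[OF \<rho>], unfolded dim])
      show "(\<lambda>x. norm (f x) powr (q / \<xi>)) \<in> borel_measurable lebesgue"
        by (intro measurable_completion) measurable
      show "(\<integral>\<^sup>+x\<in>ball 0 \<rho>. ennreal ((norm (f x) powr (q / \<xi>)) powr \<xi> * w x) \<partial>lebesgue) \<le> ennreal J"
        using f[OF \<rho>] \<xi> by (simp add: powr_powr J_def s_def)
    qed (auto simp: J_def)
    finally have "(\<integral>\<^sup>+x\<in>ball 0 R. ennreal (norm (f (A *v x)) powr (q / \<xi>)) \<partial>lborel)
      \<le> ennreal d * ennreal (C1 * \<rho> ^ CARD('n) * (J / ball_weight w \<rho>) powr (1 / \<xi>))"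
      by (simp add: mult_left_mono)
    also have "\<dots> = ennreal (d * (C1 * \<rho> ^ CARD('n) * (J / ball_weight w \<rho>) powr (1 / \<xi>)))"
      using d C1 \<rho> by (simp add: ennreal_mult)
    \<comment> \<open>Pulling everything under one power q / \<xi> gives the determinant its
      exponent \<xi> / q, as in \<open>C4\<close>.\<close>
    also have "d * (C1 * \<rho> ^ CARD('n) * (J / ball_weight w \<rho>) powr (1 / \<xi>))
      = (d powr (\<xi> / q) * C1 powr (\<xi> / q) * \<rho> powr (n * \<xi> / q) * N * ball_weight v \<rho> powr s / ball_weight w \<rho> powr (1 / q)) powr (q / \<xi>)"
    proof -
      have "\<rho> ^ CARD('n) = \<rho> powr n" using \<rho> by (simp add: n_def powr_realpow)
      then show ?thesis
        using d C1 \<rho> N Wpos[OF \<rho>] Vpos[OF \<rho>] q \<xi>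
        by (simp add: J_def powr_mult powr_divide powr_powr)
    qed
    also have "\<dots> \<le> (d powr (\<xi> / q) * C1 powr (\<xi> / q) * \<rho> powr (n * \<xi> / q) * N
        * (Cv powr s * \<alpha> powr s * ball_weight v R powr s) * (Cw powr (1 / q) * \<gamma> powr (1 / q) / ball_weight w R powr (1 / q))) powr (q / \<xi>)"
    proof -
      \<comment> \<open>An upper bound for v survives the power because s = l + 1 / q is
        nonnegative.\<close>
      have "ball_weight v \<rho> powr s \<le> (Cv * \<alpha> * ball_weight v R) powr s"
        using VR[OF a R] s by (intro powr_mono2) (auto simp: \<rho>_def \<alpha>_def)
      also have "\<dots> = Cv powr s * \<alpha> powr s * ball_weight v R powr s"
        using Cv \<alpha> by (simp add: powr_mult)
      finally have V: "ball_weight v \<rho> powr s \<le> Cv powr s * \<alpha> powr s * ball_weight v R powr s" .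
      \<comment> \<open>The weight w of the dilated ball stands in a denominator, so here a lower
        bound for it is wanted.\<close>
      have "ball_weight w R powr (1 / q) \<le> (Cw * \<gamma> * ball_weight w \<rho>) powr (1 / q)"
        using WR[OF a R] q by (intro powr_mono2) (auto simp: \<rho>_def \<gamma>_def)
      also have "\<dots> = Cw powr (1 / q) * \<gamma> powr (1 / q) * ball_weight w \<rho> powr (1 / q)"
        using Cw \<gamma> by (simp add: powr_mult)
      finally have W: "1 / ball_weight w \<rho> powr (1 / q) \<le> Cw powr (1 / q) * \<gamma> powr (1 / q) / ball_weight w R powr (1 / q)"
        using Wpos[OF \<rho>] Wpos[OF R] by (simp add: field_simps)
      have "d powr (\<xi> / q) * C1 powr (\<xi> / q) * \<rho> powr (n * \<xi> / q) * N * ball_weight v \<rho> powr s * (1 / ball_weight w \<rho> powr (1 / q))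
        \<le> d powr (\<xi> / q) * C1 powr (\<xi> / q) * \<rho> powr (n * \<xi> / q) * N
        * (Cv powr s * \<alpha> powr s * ball_weight v R powr s) * (Cw powr (1 / q) * \<gamma> powr (1 / q) / ball_weight w R powr (1 / q))"
        using N by (intro mult_mono V W order_refl) auto
      then show ?thesis using N q \<xi> by (intro powr_mono2) auto
    qed
    also have "d powr (\<xi> / q) * C1 powr (\<xi> / q) * \<rho> powr (n * \<xi> / q) * N
        * (Cv powr s * \<alpha> powr s * ball_weight v R powr s) * (Cw powr (1 / q) * \<gamma> powr (1 / q) / ball_weight w R powr (1 / q))
      = C1 powr (\<xi> / q) * Cv powr s * Cw powr (1 / q) * R powr (n * \<xi> / q) * (kernel_factor q l \<xi> \<eta> \<delta>1 \<delta>2 A * N)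
            * ball_weight v R powr s / ball_weight w R powr (1 / q)"
      unfolding K \<rho>_def using a R by (simp add: powr_mult)
    finally show "(\<integral>\<^sup>+x\<in>ball 0 R. ennreal (norm (f (A *v x)) powr (q / \<xi>)) \<partial>lborel)
        \<le> ennreal ((C1 powr (\<xi> / q) * Cv powr s * Cw powr (1 / q) * R powr (real CARD('n) * \<xi> / q) * (kernel_factor q l \<xi> \<eta> \<delta>1 \<delta>2 A * N)
            * ball_weight v R powr (l + 1 / q) / ball_weight w R powr (1 / q)) powr (q / \<xi>))"
      by (simp add: n_def s_def ennreal_leI)
  qed
qed

text \<open>Hoelder's inequality for m + 1 functions: the exponents p \<xi> / qi i add up to p \<xi>
  / q, and r is chosen so that 1 / r is the missing rest. The result is homogeneous in R, hence
  involves only the weight of the ball under v.\<close>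

lemma nn_integral_slice_le:
  fixes v w :: "real^'n \<Rightarrow> real" and qi l :: "nat \<Rightarrow> real"
  assumes mw: "muckenhoupt \<xi> w" and \<xi>: "1 \<le> \<xi>" and mv: "muckenhoupt \<eta> v" and \<eta>: "1 \<le> \<eta>"
    and crit: "critical_index w \<noteq> \<infinity>" "critical_index v \<noteq> \<infinity>"
    and \<delta>1: "1 < \<delta>1" "ereal \<delta>1 < critical_index w" and \<delta>2: "1 < \<delta>2" "ereal \<delta>2 < critical_index v"
    and q: "1 \<le> q" and qi: "\<And>i. i \<in> {1..m} \<Longrightarrow> 1 \<le> qi i" and sum: "(\<Sum>i=1..m. 1 / qi i) = 1 / q"
    and l: "\<And>i. i \<in> {1..m} \<Longrightarrow> - (1 / qi i) < l i"
    and p: "1 \<le> p" and r': "1 / real_of_ereal (critical_index w) + 1 / r' = 1" "q > p * \<xi> * r'"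
    and dom: "\<exists>C>0. \<forall>R>0. weight_measure w (ball 0 R) \<le> ennreal C * weight_measure v (ball 0 R)"
  obtains C where "0 < C"
    "\<And>A R f N. \<lbrakk>0 < R; \<And>i. i \<in> {1..m} \<Longrightarrow> det (A i) \<noteq> 0; \<And>i. i \<in> {1..m} \<Longrightarrow> f i \<in> borel_measurable borel;
      \<And>i. i \<in> {1..m} \<Longrightarrow> 0 \<le> N i;
      \<And>i \<rho>. \<lbrakk>i \<in> {1..m}; 0 < \<rho>\<rbrakk> \<Longrightarrow> (\<integral>\<^sup>+x\<in>ball 0 \<rho>. ennreal (norm (f i x) powr qi i * w x) \<partial>lebesgue)
        \<le> ennreal ((N i * ball_weight v \<rho> powr (l i + 1 / qi i)) powr qi i)\<rbrakk>
     \<Longrightarrow> (\<integral>\<^sup>+x\<in>ball 0 R. ennreal ((\<Prod>i=1..m. norm (f i (A i *v x) :: complex)) powr p * w x) \<partial>lebesgue)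
        \<le> ennreal ((C * (\<Prod>i=1..m. kernel_factor (qi i) (l i) \<xi> \<eta> \<delta>1 \<delta>2 (A i)) * (\<Prod>i=1..m. N i)
            * ball_weight v R powr ((\<Sum>i=1..m. l i) + 1 / p)) powr p)"
proof -
  note w = muckenhoupt_weight[OF mw] and v = muckenhoupt_weight[OF mv]
  note [measurable] = weight_measurable[OF w]
  note Wpos = muckenhoupt_ball_weight_pos[OF mw \<xi> crit(1)]
  note Vpos = muckenhoupt_ball_weight_pos[OF mv \<eta> crit(2)]
  define n where "n = real CARD('n)"
  define ls where "ls = (\<Sum>i=1..m. l i)"
  define rc where "rc = real_of_ereal (critical_index w)"
  have rc: "critical_index w = ereal rc"
    using crit(1) \<delta>1(2) by (cases "critical_index w") (auto simp: rc_def)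
  have rc1: "1 < rc" using \<delta>1 rc by simp
  \<comment> \<open>r' is given only through its equation; together with 1 < rc this makes it
    positive, so dividing the hypothesis on q by r' keeps its direction.\<close>
  have r'pos: "0 < r'" using r'(1) rc1 unfolding rc_def[symmetric]
    by (smt (verit) divide_less_eq_1_pos zero_less_divide_1_iff)
  define r where "r = 1 / (1 - p * \<xi> / q)"
  have "p * \<xi> / q < 1 / r'" using r'(2) r'pos q by (simp add: field_simps)
  then have pq: "p * \<xi> / q < 1 - 1 / rc" using r'(1) by (simp add: rc_def)
  have pq0: "0 < p * \<xi> / q" using p \<xi> q by simp
  have "0 < 1 / rc" using rc1 by simp
  then have pq1: "p * \<xi> / q < 1" using pq by linarith
  have r1: "1 < r" unfolding r_def using pq0 pq1 by (simp add: field_simps)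
  have inv_r: "1 / r = 1 - p * \<xi> / q" by (simp add: r_def)
  have "1 / rc < 1 / r" using pq inv_r by linarith
  then have "r < rc" using rc1 r1 by (simp add: field_simps)
  then have rcrit: "ereal r < critical_index w" by (simp add: rc)
  obtain Cr where Cr: "0 < Cr" and RH:
    "\<And>R. 0 < R \<Longrightarrow> (\<integral>\<^sup>+x\<in>ball 0 R. ennreal (w x powr r) \<partial>lebesgue)
       \<le> ennreal (Cr * R ^ DIM(real^'n) * (ball_weight w R / R ^ DIM(real^'n)) powr r)"
    using critical_index_reverse_Holder[OF w r1 rcrit] by blast
  obtain C0 where C0: "0 < C0" and WV: "\<And>R. 0 < R \<Longrightarrow> ball_weight w R \<le> C0 * ball_weight v R"
  proof -
    obtain C0 where C0: "0 < C0" "\<forall>R>0. weight_measure w (ball 0 R) \<le> ennreal C0 * weight_measure v (ball 0 R)"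
      using dom by blast
    then have "ball_weight w R \<le> C0 * ball_weight v R" if "0 < R" for R
      using that unfolding weight_measure_eq_ball_weight[OF w] weight_measure_eq_ball_weight[OF v]
      by (simp add: ennreal_mult[symmetric])
    with C0(1) show ?thesis using that by blast
  qed
  define D where "D i A = kernel_factor (qi i) (l i) \<xi> \<eta> \<delta>1 \<delta>2 (A :: real^'n^'n)" for i A
  \<comment> \<open>Names the estimate for a single index, so that its constants can be chosen as a
    function of i.\<close>
  define Q where "Q i C \<longleftrightarrow> (\<forall>A R f N. det A \<noteq> 0 \<longrightarrow> 0 < R \<longrightarrow> f \<in> borel_measurable borel \<longrightarrow> 0 \<le> N \<longrightarrow>
      (\<forall>\<rho>>0. (\<integral>\<^sup>+x\<in>ball 0 \<rho>. ennreal (norm (f x :: complex) powr qi i * w x) \<partial>lebesgue)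
        \<le> ennreal ((N * ball_weight v \<rho> powr (l i + 1 / qi i)) powr qi i))
     \<longrightarrow> (\<integral>\<^sup>+x\<in>ball 0 R. ennreal (norm (f (A *v x)) powr (qi i / \<xi>)) \<partial>lborel)
        \<le> ennreal ((C * R powr (n * \<xi> / qi i) * (D i A * N)
            * ball_weight v R powr (l i + 1 / qi i) / ball_weight w R powr (1 / qi i)) powr (qi i / \<xi>)))" for i C
  have "\<exists>C>0. Q i C" if i: "i \<in> {1..m}" for i
  proof -
    have "0 < qi i" "0 \<le> l i + 1 / qi i" using qi[OF i] l[OF i] by auto
    from nn_integral_dilated_factor_le[OF mw \<xi> mv \<eta> crit \<delta>1 \<delta>2 this]
    obtain C where C: "0 < C" and H: "\<And>A R f N. \<lbrakk>det A \<noteq> 0; 0 < R; f \<in> borel_measurable borel; 0 \<le> N;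
      \<And>\<rho>. 0 < \<rho> \<Longrightarrow> (\<integral>\<^sup>+x\<in>ball 0 \<rho>. ennreal (norm (f x) powr qi i * w x) \<partial>lebesgue)
        \<le> ennreal ((N * ball_weight v \<rho> powr (l i + 1 / qi i)) powr qi i)\<rbrakk>
     \<Longrightarrow> (\<integral>\<^sup>+x\<in>ball 0 R. ennreal (norm (f (A *v x) :: complex) powr (qi i / \<xi>)) \<partial>lborel)
        \<le> ennreal ((C * R powr (real CARD('n) * \<xi> / qi i) * (kernel_factor (qi i) (l i) \<xi> \<eta> \<delta>1 \<delta>2 A * N)
            * ball_weight v R powr (l i + 1 / qi i) / ball_weight w R powr (1 / qi i)) powr (qi i / \<xi>))"
      by blast
    have "Q i C" unfolding Q_def n_def D_def by (intro allI impI H) auto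
    with C show ?thesis by blast
  qed
  then obtain c where c: "\<And>i. i \<in> {1..m} \<Longrightarrow> 0 < c i" and Qc: "\<And>i. i \<in> {1..m} \<Longrightarrow> Q i (c i)"
    by metis
  \<comment> \<open>The power of the weight of the ball under w that remains at the end. It must be
    nonnegative to be compared with v; this holds since p \<le> p \<xi> < q.\<close>
  define e where "e = 1 - p / q"
  have e: "0 \<le> e"
  proof -
    have "p \<le> p * \<xi>" using p \<xi> by (simp add: mult_le_cancel_left1)
    then have "p / q \<le> p * \<xi> / q" using q by (intro divide_right_mono) auto
    then show ?thesis using pq1 by (simp add: e_def)
  qed
  define cp where "cp = (\<Prod>i=1..m. c i)"
  have prod_c: "0 < cp" unfolding cp_def using c by (intro prod_pos) auto
  \<comment> \<open>Constants are collected at the level of p-th powers; the final one is the p-th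
    root.\<close>
  define K where "K = cp powr p * Cr powr (1 / r) * C0 powr e"
  have K: "0 < K" using prod_c Cr C0 by (simp add: K_def)
  show ?thesis
  proof (rule that[of "K powr (1 / p)"])
    show "0 < K powr (1 / p)" using K by simp
    fix A :: "nat \<Rightarrow> real^'n^'n" and R :: real and f :: "nat \<Rightarrow> real^'n \<Rightarrow> complex" and N :: "nat \<Rightarrow> real"
    assume R: "0 < R" and A: "\<And>i. i \<in> {1..m} \<Longrightarrow> det (A i) \<noteq> 0"
      and f: "\<And>i. i \<in> {1..m} \<Longrightarrow> f i \<in> borel_measurable borel" and N: "\<And>i. i \<in> {1..m} \<Longrightarrow> 0 \<le> N i"
      and M: "\<And>i \<rho>. \<lbrakk>i \<in> {1..m}; 0 < \<rho>\<rbrakk> \<Longrightarrow> (\<integral>\<^sup>+x\<in>ball 0 \<rho>. ennreal (norm (f i x) powr qi i * w x) \<partial>lebesgue)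
        \<le> ennreal ((N i * ball_weight v \<rho> powr (l i + 1 / qi i)) powr qi i)"
    define W where "W = ball_weight w R"
    define V where "V = ball_weight v R"
    have W: "0 < W" and V: "0 < V" using Wpos[OF R] Vpos[OF R] by (auto simp: W_def V_def)
    define B where "B = indicat_real (ball (0::real^'n) R)"
    have B[measurable]: "B \<in> borel_measurable lebesgue" unfolding B_def by (intro borel_measurable_indicator) simp
    define Y where "Y i = c i * R powr (n * \<xi> / qi i) * (D i (A i) * N i) * V powr (l i + 1 / qi i) / W powr (1 / qi i)" for i
    have D0: "0 \<le> D i X" for i X by (simp add: D_def kernel_factor_nonneg)
    define J0 where "J0 = Cr * R powr n * (W / R powr n) powr r"
    \<comment> \<open>The factors are numbered from 1, so index 0 is free to carry the
      weight.\<close>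
    define F where "F i x = (if i = 0 then w x powr r * B x else norm (f i (A i *v x)) powr (qi i / \<xi>) * B x)" for i x
    define \<theta> where "\<theta> i = (if i = 0 then 1 / r else p * \<xi> / qi i)" for i
    define J where "J i = (if i = 0 then J0 else Y i powr (qi i / \<xi>))" for i
    have I: "{..m} = insert 0 {1..m}" by auto
    have "(\<integral>\<^sup>+x. ennreal (\<Prod>i\<in>{..m}. F i x powr \<theta> i) \<partial>lebesgue) \<le> ennreal (\<Prod>i\<in>{..m}. J i powr \<theta> i)"
    proof (rule nn_integral_Holder)
      fix i assume i: "i \<in> {..m}"
      show "F i \<in> borel_measurable lebesgue"
      proof (cases "i = 0")
        case True then show ?thesis unfolding F_def by simp
      next
        case False
        then have [measurable]: "f i \<in> borel_measurable borel" using i by (intro f) auto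
        have [measurable]: "(\<lambda>x. norm (f i (A i *v x)) powr (qi i / \<xi>)) \<in> borel_measurable lebesgue"
          by (intro measurable_completion) measurable
        show ?thesis unfolding F_def using False by simp
      qed
      show "0 \<le> \<theta> i" using r1 p \<xi> qi[of i] i by (auto simp: \<theta>_def)
      show "0 \<le> J i" using Cr R W by (simp add: J_def J0_def)
      show "(\<integral>\<^sup>+x. ennreal (F i x) \<partial>lebesgue) \<le> ennreal (J i)"
      proof (cases "i = 0")
        case True
        have "ennreal (F i x) = ennreal (w x powr r) * indicator (ball 0 R) x" for x
          using True by (simp add: F_def B_def indicator_def)
        then show ?thesis using RH[OF R] R True
          by (simp add: J_def J0_def W_def n_def powr_realpow)
      next
        case False
        then have i': "i \<in> {1..m}" using i by auto
        have "ennreal (F i x) = ennreal (norm (f i (A i *v x)) powr (qi i / \<xi>)) * indicator (ball 0 R) x" for x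
          using False by (simp add: F_def B_def indicator_def)
        then show ?thesis
          using Qc[OF i'] A[OF i'] R f[OF i'] N[OF i'] M[OF i'] False
          unfolding Q_def by (simp add: J_def Y_def V_def W_def nn_integral_completion)
      qed
    next
      show "0 \<le> F i x" for i x by (simp add: F_def B_def)
      have "(\<Sum>i\<in>{..m}. \<theta> i) = 1 / r + p * \<xi> * (\<Sum>i=1..m. 1 / qi i)"
        unfolding I by (simp add: \<theta>_def sum_distrib_left)
      then show "(\<Sum>i\<in>{..m}. \<theta> i) = 1" unfolding sum inv_r by simp
    qed simp
    also have "(\<Prod>i\<in>{..m}. J i powr \<theta> i) = J0 powr (1 / r) * (\<Prod>i=1..m. Y i powr p)"
    proof -
      have "(\<Prod>i=1..m. J i powr \<theta> i) = (\<Prod>i=1..m. Y i powr p)"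
      proof (rule prod.cong[OF refl])
        fix i assume i: "i \<in> {1..m}"
        \<comment> \<open>The inner and the Hoelder exponent multiply to p for every i, so the m
          factors merge into one p-th power.\<close>
        have "qi i / \<xi> * (p * \<xi> / qi i) = p" using qi[OF i] \<xi> by simp
        then show "J i powr \<theta> i = Y i powr p" using i by (simp add: J_def \<theta>_def powr_powr)
      qed
      then show ?thesis unfolding I by (simp add: J_def \<theta>_def)
    qed
    also have "(\<Prod>i=1..m. Y i powr p) = (\<Prod>i=1..m. Y i) powr p"
      by (rule prod_powr_distrib[symmetric])
    also have "(\<Prod>i=1..m. Y i) = cp * R powr (n * \<xi> / q) * ((\<Prod>i=1..m. D i (A i)) * (\<Prod>i=1..m. N i))
        * V powr (ls + 1 / q) / W powr (1 / q)"
    proof -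
      have "(\<Prod>i=1..m. R powr (n * \<xi> / qi i)) = R powr (\<Sum>i=1..m. n * \<xi> / qi i)"
        using R by (simp add: powr_sum)
      also have "(\<Sum>i=1..m. n * \<xi> / qi i) = n * \<xi> * (\<Sum>i=1..m. 1 / qi i)"
        by (simp add: sum_distrib_left)
      also have "\<dots> = n * \<xi> / q" unfolding sum by simp
      finally have "(\<Prod>i=1..m. R powr (n * \<xi> / qi i)) = R powr (n * \<xi> / q)" .
      moreover have "(\<Prod>i=1..m. V powr (l i + 1 / qi i)) = V powr (ls + 1 / q)"
        unfolding powr_sum[OF less_imp_neq[OF V, symmetric], symmetric] sum.distrib ls_def sum ..
      moreover have "(\<Prod>i=1..m. W powr (1 / qi i)) = W powr (1 / q)"
        unfolding powr_sum[OF less_imp_neq[OF W, symmetric], symmetric] sum ..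
      ultimately show ?thesis by (simp add: Y_def prod.distrib prod_dividef cp_def)
    qed
    finally have est: "(\<integral>\<^sup>+x. ennreal (\<Prod>i\<in>{..m}. F i x powr \<theta> i) \<partial>lebesgue)
      \<le> ennreal (J0 powr (1 / r) * (cp * R powr (n * \<xi> / q) * ((\<Prod>i=1..m. D i (A i)) * (\<Prod>i=1..m. N i))
        * V powr (ls + 1 / q) / W powr (1 / q)) powr p)" .
    define P where "P = (\<Prod>i=1..m. D i (A i)) * (\<Prod>i=1..m. N i)"
    have P: "0 \<le> P" using D0 N by (auto simp: P_def intro!: mult_nonneg_nonneg prod_nonneg)
    have "J0 powr (1 / r) = Cr powr (1 / r) * R powr (n / r) * (W / R powr n)"
      using Cr R W r1 by (simp add: J0_def powr_mult powr_powr powr_divide)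
    moreover have "(cp * R powr (n * \<xi> / q) * P * V powr (ls + 1 / q) / W powr (1 / q)) powr p
      = cp powr p * R powr (n * \<xi> / q * p) * P powr p * V powr ((ls + 1 / q) * p) / W powr (p / q)"
      using prod_c R P V W by (simp add: powr_mult powr_divide powr_powr)
    ultimately have "J0 powr (1 / r) * (cp * R powr (n * \<xi> / q) * P * V powr (ls + 1 / q) / W powr (1 / q)) powr p
      = cp powr p * Cr powr (1 / r) * (R powr (n / r) * R powr (n * \<xi> / q * p) / R powr n) * P powr p
        * V powr ((ls + 1 / q) * p) * (W / W powr (p / q))"
      by simp
    \<comment> \<open>The choice of r makes all powers of the radius cancel: n / r + n \<xi> p / q =
      n.\<close>
    also have "R powr (n / r) * R powr (n * \<xi> / q * p) / R powr n = 1"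
    proof -
      have "n / r + n * \<xi> / q * p = n * (1 / r + p * \<xi> / q)" by (simp add: field_simps)
      also have "\<dots> = n" by (simp add: inv_r)
      finally show ?thesis using R by (simp add: powr_add[symmetric])
    qed
    also have "W / W powr (p / q) = W powr e"
      using W by (simp add: e_def powr_diff)
    \<comment> \<open>Here the domination of \<omega> by v on centred balls enters. The extra power
      e = 1 - p / q of V then raises the exponent (ls + 1 / q) * p to (ls + 1 / p) * p.\<close>
    also have "cp powr p * Cr powr (1 / r) * 1 * P powr p * V powr ((ls + 1 / q) * p) * W powr e
      \<le> cp powr p * Cr powr (1 / r) * 1 * P powr p * V powr ((ls + 1 / q) * p) * (C0 * V) powr e"
      using WV[OF R] W e by (intro mult_left_mono powr_mono2) (auto simp: W_def V_def intro!: mult_nonneg_nonneg)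
    also have "\<dots> = K * P powr p * (V powr ((ls + 1 / q) * p) * V powr e)"
      using C0 V by (simp add: K_def powr_mult)
    also have "V powr ((ls + 1 / q) * p) * V powr e = V powr ((ls + 1 / p) * p)"
      using p by (simp add: powr_add[symmetric] e_def algebra_simps)
    also have "K * P powr p * V powr ((ls + 1 / p) * p) = (K powr (1 / p) * P * V powr (ls + 1 / p)) powr p"
      using K P V p by (simp add: powr_mult powr_powr)
    finally have fin: "(\<integral>\<^sup>+x. ennreal (\<Prod>i\<in>{..m}. F i x powr \<theta> i) \<partial>lebesgue)
      \<le> ennreal ((K powr (1 / p) * P * V powr (ls + 1 / p)) powr p)"
      using est unfolding P_def[symmetric] by (auto intro: order_trans ennreal_leI)
    have "(\<integral>\<^sup>+x\<in>ball 0 R. ennreal ((\<Prod>i=1..m. norm (f i (A i *v x))) powr p * w x) \<partial>lebesgue)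
      = (\<integral>\<^sup>+x. ennreal (\<Prod>i\<in>{..m}. F i x powr \<theta> i) \<partial>lebesgue)"
    proof (rule nn_integral_cong)
      fix x :: "real^'n"
      show "ennreal ((\<Prod>i=1..m. norm (f i (A i *v x))) powr p * w x) * indicator (ball 0 R) x
        = ennreal (\<Prod>i\<in>{..m}. F i x powr \<theta> i)"
      proof (cases "x \<in> ball 0 R")
        case True
        then have B1: "B x = 1" by (simp add: B_def)
        have "(\<Prod>i=1..m. F i x powr \<theta> i) = (\<Prod>i=1..m. norm (f i (A i *v x)) powr p)"
        proof (rule prod.cong[OF refl])
          fix i assume i: "i \<in> {1..m}"
          have "qi i / \<xi> * (p * \<xi> / qi i) = p" using qi[OF i] \<xi> by simp
          then show "F i x powr \<theta> i = norm (f i (A i *v x)) powr p"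
            using i by (simp add: F_def B1 \<theta>_def powr_powr)
        qed
        also have "\<dots> = (\<Prod>i=1..m. norm (f i (A i *v x))) powr p"
          by (rule prod_powr_distrib[symmetric])
        moreover have "F 0 x powr \<theta> 0 = w x"
          using r1 weight_nonneg[OF w, of x] by (simp add: F_def B1 \<theta>_def powr_powr)
        ultimately show ?thesis using True unfolding I by (simp add: mult.commute)
      next
        case False
        then have "F 0 x powr \<theta> 0 = 0" by (simp add: F_def B_def)
        then show ?thesis using False unfolding I by simp
      qed
    qed
    with fin show "(\<integral>\<^sup>+x\<in>ball 0 R. ennreal ((\<Prod>i=1..m. norm (f i (A i *v x))) powr p * w x) \<partial>lebesgue)
        \<le> ennreal ((K powr (1 / p) * (\<Prod>i=1..m. kernel_factor (qi i) (l i) \<xi> \<eta> \<delta>1 \<delta>2 (A i)) * (\<Prod>i=1..m. N i)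
            * ball_weight v R powr ((\<Sum>i=1..m. l i) + 1 / p)) powr p)"
      by (simp add: P_def V_def D_def ls_def mult.assoc)
  qed
qed

section \<open>Measurability and Morrey norms\<close>

text \<open>The real-valued case for completions, applied to each coordinate. Unlike Lebesgue
  measurable functions, Borel representatives may be composed with each other.\<close>

lemma lebesgue_measurable_Borel_representative:
  fixes f :: "'a::euclidean_space \<Rightarrow> 'b::euclidean_space"
  assumes f: "f \<in> borel_measurable lebesgue"
  obtains g where "g \<in> borel_measurable borel" "AE x in lborel. f x = g x"
proof -
  have "\<exists>h\<in>borel_measurable lborel. AE x in lborel. f x \<bullet> b = h x" for b
    by (rule completion_ex_borel_measurable_real) (use f in measurable)
  then obtain h where h: "\<And>b. h b \<in> borel_measurable lborel" "\<And>b. AE x in lborel. f x \<bullet> b = h b x"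
    by metis
  have [measurable]: "h b \<in> borel_measurable borel" for b using h(1) by simp
  show ?thesis
  proof (rule that[of "\<lambda>x. \<Sum>b\<in>Basis. h b x *\<^sub>R b"])
    show "(\<lambda>x. \<Sum>b\<in>Basis. h b x *\<^sub>R b) \<in> borel_measurable borel" by measurable
    have "AE x in lborel. \<forall>b\<in>Basis. f x \<bullet> b = h b x"
      by (rule AE_finite_allI) (use h in auto)
    then show "AE x in lborel. f x = (\<Sum>b\<in>Basis. h b x *\<^sub>R b)"
    proof eventually_elim
      case (elim x)
      have "f x = (\<Sum>b\<in>Basis. (f x \<bullet> b) *\<^sub>R b)" by (simp add: euclidean_representation)
      also have "\<dots> = (\<Sum>b\<in>Basis. h b x *\<^sub>R b)" using elim by (intro sum.cong) auto
      finally show ?case .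
    qed
  qed
qed

lemma borel_measurable_vec_nth[measurable]: "(\<lambda>x. x $ i) \<in> borel_measurable borel"
  by (intro borel_measurable_continuous_onI continuous_intros)

lemma borel_measurable_det[measurable]: "(det :: real^'n^'n \<Rightarrow> real) \<in> borel_measurable borel"
  unfolding det_def by (intro borel_measurable_continuous_onI continuous_intros)

lemma borel_measurable_matrix_vector_mult[measurable (raw)]:
  fixes f :: "'a \<Rightarrow> real^'n^'m" and g :: "'a \<Rightarrow> real^'n"
  assumes "f \<in> borel_measurable M" "g \<in> borel_measurable M"
  shows "(\<lambda>x. f x *v g x) \<in> borel_measurable M"
  using assms
  by (rule borel_measurable_continuous_Pair) (unfold matrix_vector_mult_def, intro continuous_intros)

text \<open>On singular matrices \<open>matrix_inv\<close> is one fixed junk matrix.\<close>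

lemma abs_det_matrix_inv_cases:
  fixes A :: "real^'n^'n"
  shows "\<bar>det (matrix_inv A)\<bar> = (if det A = 0 then \<bar>det (SOME B :: real^'n^'n. False)\<bar> else 1 / \<bar>det A\<bar>)"
proof (cases "det A = 0")
  case True
  then have "\<not> invertible A" by (simp add: invertible_det_nz)
  then have "(\<lambda>B. A ** B = mat 1 \<and> B ** A = mat 1) = (\<lambda>B. False)"
    by (auto simp: invertible_def fun_eq_iff)
  then show ?thesis using True by (simp add: matrix_inv_def)
qed (simp add: abs_det_matrix_inv)

lemma borel_measurable_kernel_factor[measurable]:
  "kernel_factor q l \<xi> \<eta> \<delta>1 \<delta>2 \<in> borel_measurable (borel :: (real^'n^'n) measure)"
  unfolding kernel_factor_def[abs_def] Let_def abs_det_matrix_inv_cases by measurable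

lemma C4_integrand_eq:
  "(\<Prod>i=1..m. \<bar>det (matrix_inv (A i y))\<bar> powr (\<xi> / q i) * norm (A i y) powr (\<xi> * real CARD('n) / q i))
      * A_factor m A q l \<xi> \<eta> \<delta>1 \<delta>2 y
    = (\<Prod>i=1..m. kernel_factor (q i) (l i) \<xi> \<eta> \<delta>1 \<delta>2 (A i y :: real^'n^'n))"
  unfolding A_factor_def Let_def prod.distrib[symmetric]
  by (rule prod.cong) (auto simp: kernel_factor_def Let_def indicator_def)

text \<open>By the substitution formula the preimage of N has measure 0. This makes the choice of a
  representative of \<open>f i\<close> harmless under a nonsingular substitution.\<close>

lemma AE_linear_image_notin_null:
  fixes A :: "real^'n^'n"
  assumes A: "det A \<noteq> 0" and N: "N \<in> null_sets lborel"
  shows "AE x in lborel. A *v x \<notin> N"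
proof -
  have [measurable]: "N \<in> sets borel" using N by (auto simp: null_sets_def)
  have "(\<integral>\<^sup>+x. indicator N (A *v x) \<partial>lborel) = 0"
    using N by (subst nn_integral_linear_substitution[OF A]) auto
  then have "AE x in lborel. indicator N (A *v x) = (0 :: ennreal)"
    by (subst (asm) nn_integral_0_iff_AE) auto
  then show ?thesis by eventually_elim (auto simp: indicator_def)
qed

section \<open>Morrey norms and integrals over centred balls\<close>

lemma morrey_space_ball_bound:
  fixes v w :: "'a::euclidean_space \<Rightarrow> real"
  assumes f: "f \<in> morrey_space v w q l" and q: "0 < q" and v: "weight v"
    and V: "\<And>R. 0 < R \<Longrightarrow> 0 < ball_weight v R" and \<rho>: "0 < \<rho>"
  shows "(\<integral>\<^sup>+x\<in>ball 0 \<rho>. ennreal (norm (f x) powr q * w x) \<partial>lebesgue)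
    \<le> ennreal ((enn2real (morrey_norm v w q l f) * ball_weight v \<rho> powr (l + 1 / q)) powr q)"
proof -
  define N where "N = enn2real (morrey_norm v w q l f)"
  have N: "morrey_norm v w q l f = ennreal N" "0 \<le> N"
    using f by (auto simp: morrey_space_def N_def less_top)
  define s where "s = l + 1 / q"
  let ?I = "\<integral>\<^sup>+x\<in>ball 0 \<rho>. ennreal (norm (f x) powr q * w x) \<partial>lebesgue"
  have "?I \<le> (\<integral>\<^sup>+x\<in>cball 0 \<rho>. ennreal (norm (f x) powr q * w x) \<partial>lebesgue)"
    by (intro nn_integral_mono) (auto simp: indicator_def)
  also have "\<dots> < \<infinity>" using f by (auto simp: morrey_space_def)
  finally obtain J where J: "?I = ennreal J" "0 \<le> J" by (cases ?I) auto
  have Vp: "0 < ball_weight v \<rho> powr s" using V[OF \<rho>] by simp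
  have "1 / epowr (weight_measure v (ball 0 \<rho>)) s * epowr ?I (1 / q) \<le> ennreal N"
    unfolding N(1)[symmetric] morrey_norm_def s_def by (rule SUP_upper) (use \<rho> in auto)
  also have "epowr (weight_measure v (ball 0 \<rho>)) s = ennreal (ball_weight v \<rho> powr s)"
    using V[OF \<rho>] by (simp add: weight_measure_eq_ball_weight[OF v] epowr_ennreal)
  also have "epowr ?I (1 / q) = ennreal (J powr (1 / q))"
    using J q by (simp add: epowr_ennreal_pos)
  also have "1 / ennreal (ball_weight v \<rho> powr s) = ennreal (1 / ball_weight v \<rho> powr s)"
    using Vp by (simp add: divide_ennreal flip: ennreal_1)
  finally have "1 / ball_weight v \<rho> powr s * J powr (1 / q) \<le> N"
    using N(2) by (simp add: ennreal_mult[symmetric])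
  then have "J powr (1 / q) \<le> N * ball_weight v \<rho> powr s" using Vp by (simp add: field_simps)
  then have "(J powr (1 / q)) powr q \<le> (N * ball_weight v \<rho> powr s) powr q"
    using q by (intro powr_mono2) auto
  then have "J \<le> (N * ball_weight v \<rho> powr s) powr q" using q J by (simp add: powr_powr)
  then show ?thesis unfolding J(1) N_def s_def by (rule ennreal_leI)
qed

text \<open>Converse of \<open>morrey_space_ball_bound\<close>. The bounds on centred balls also
  give finiteness on compact sets, each of which lies in such a ball.\<close>

lemma morrey_space_ballI:
  fixes v w :: "'a::euclidean_space \<Rightarrow> real"
  assumes h: "h \<in> borel_measurable lebesgue" and q: "0 < q" and v: "weight v"
    and V: "\<And>R. 0 < R \<Longrightarrow> 0 < ball_weight v R" and N: "0 \<le> N"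
    and le: "\<And>R. 0 < R \<Longrightarrow> (\<integral>\<^sup>+x\<in>ball 0 R. ennreal (norm (h x) powr q * w x) \<partial>lebesgue)
      \<le> ennreal ((N * ball_weight v R powr (l + 1 / q)) powr q)"
  shows "h \<in> morrey_space v w q l" "morrey_norm v w q l h \<le> ennreal N"
proof -
  define s where "s = l + 1 / q"
  have "1 / epowr (weight_measure v (ball 0 R)) s
      * epowr (\<integral>\<^sup>+x\<in>ball 0 R. ennreal (norm (h x) powr q * w x) \<partial>lebesgue) (1 / q) \<le> ennreal N"
    if R: "0 < R" for R
  proof -
    have Vp: "0 < ball_weight v R powr s" using V[OF R] by simp
    let ?I = "\<integral>\<^sup>+x\<in>ball 0 R. ennreal (norm (h x) powr q * w x) \<partial>lebesgue"
    have "?I < \<infinity>" using le[OF R] by (auto simp: less_top[symmetric] top_unique)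
    then obtain J where J: "?I = ennreal J" "0 \<le> J" by (cases ?I) auto
    have "J \<le> (N * ball_weight v R powr s) powr q" using le[OF R] unfolding J s_def by simp
    then have "J powr (1 / q) \<le> ((N * ball_weight v R powr s) powr q) powr (1 / q)"
      using q J by (intro powr_mono2) auto
    also have "\<dots> = N * ball_weight v R powr s" using q N by (simp add: powr_powr)
    finally have "1 / ball_weight v R powr s * J powr (1 / q) \<le> N" using Vp by (simp add: field_simps)
    moreover have "epowr (weight_measure v (ball 0 R)) s = ennreal (ball_weight v R powr s)"
      using V[OF R] by (simp add: weight_measure_eq_ball_weight[OF v] epowr_ennreal)
    moreover have "epowr ?I (1 / q) = ennreal (J powr (1 / q))"
      using J q by (simp add: epowr_ennreal_pos)
    moreover have "1 / ennreal (ball_weight v R powr s) = ennreal (1 / ball_weight v R powr s)"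
      using Vp by (simp add: divide_ennreal flip: ennreal_1)
    ultimately show ?thesis by (simp add: ennreal_mult[symmetric] ennreal_leI)
  qed
  then show norm: "morrey_norm v w q l h \<le> ennreal N"
    unfolding morrey_norm_def s_def by (intro SUP_least) auto
  have "(\<integral>\<^sup>+x\<in>K. ennreal (norm (h x) powr q * w x) \<partial>lebesgue) < \<infinity>" if K: "compact K" for K
  proof -
    obtain R where R: "0 < R" "K \<subseteq> ball 0 R"
      using compact_imp_bounded[OF K] bounded_subset_ballD by blast
    have "(\<integral>\<^sup>+x\<in>K. ennreal (norm (h x) powr q * w x) \<partial>lebesgue)
      \<le> (\<integral>\<^sup>+x\<in>ball 0 R. ennreal (norm (h x) powr q * w x) \<partial>lebesgue)"
      by (intro nn_integral_mono) (use R in \<open>auto simp: indicator_def\<close>)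
    also have "\<dots> < \<infinity>" using le[OF R(1)] by (auto simp: less_top[symmetric] top_unique)
    finally show ?thesis .
  qed
  with h norm show "h \<in> morrey_space v w q l"
    by (auto simp: morrey_space_def less_top[symmetric] top_unique)
qed

section \<open>The Hausdorff operator\<close>

text \<open>Minkowski's inequality needs a jointly measurable integrand, so the estimates run for
  Borel representatives of \<Phi>, A and f. The operator itself returns through the almost
  everywhere identity \<open>same\<close>.\<close>

lemma hausdorff_operator_morrey_bound:
  fixes m :: nat and \<Phi> :: "real^'n \<Rightarrow> complex" and A :: "nat \<Rightarrow> real^'n \<Rightarrow> real^'n^'n"
    and v w :: "real^'n \<Rightarrow> real" and qi l :: "nat \<Rightarrow> real"
  assumes \<Phi>: "locally_integrable \<Phi>"
    and A: "\<And>i. i \<in> {1..m} \<Longrightarrow> A i \<in> borel_measurable lebesgue"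
    and det: "\<And>i. i \<in> {1..m} \<Longrightarrow> AE y in lebesgue. \<Phi> y \<noteq> 0 \<longrightarrow> det (A i y) \<noteq> 0"
    and q: "1 \<le> q" and qi: "\<And>i. i \<in> {1..m} \<Longrightarrow> 1 \<le> qi i" and sum: "(\<Sum>i=1..m. 1 / qi i) = 1 / q"
    and p: "1 \<le> p" and \<xi>: "1 \<le> \<xi>" and \<eta>: "1 \<le> \<eta>"
    and l: "\<And>i. i \<in> {1..m} \<Longrightarrow> - (1 / qi i) < l i"
    and mw: "muckenhoupt \<xi> w" and mv: "muckenhoupt \<eta> v"
    and crit: "critical_index w \<noteq> \<infinity>" "critical_index v \<noteq> \<infinity>"
    and dom: "\<exists>C>0. \<forall>R>0. weight_measure w (ball 0 R) \<le> ennreal C * weight_measure v (ball 0 R)"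
    and r': "1 / real_of_ereal (critical_index w) + 1 / r' = 1" "q > p * \<xi> * r'"
    and \<delta>1: "1 < \<delta>1" "ereal \<delta>1 < critical_index w" and \<delta>2: "1 < \<delta>2" "ereal \<delta>2 < critical_index v"
    and C4: "C4 m \<Phi> A qi l \<xi> \<eta> \<delta>1 \<delta>2 < \<infinity>"
  obtains C where "0 < C"
    "\<And>f. (\<And>i. i \<in> {1..m} \<Longrightarrow> f i \<in> morrey_space v w (qi i) (l i)) \<Longrightarrow>
      (AE x in lebesgue. integrable lebesgue (hausdorff_integrand m \<Phi> A f x))
      \<and> hausdorff_operator m \<Phi> A f \<in> morrey_space v w p (\<Sum>i=1..m. l i)
      \<and> morrey_norm v w p (\<Sum>i=1..m. l i) (hausdorff_operator m \<Phi> A f)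
          \<le> ennreal C * (\<Prod>i=1..m. morrey_norm v w (qi i) (l i) (f i))"
proof -
  note w = muckenhoupt_weight[OF mw] and v = muckenhoupt_weight[OF mv]
  note Vpos = muckenhoupt_ball_weight_pos[OF mv \<eta> crit(2)]
  define ls where "ls = (\<Sum>i=1..m. l i)"
  obtain \<Phi>' where \<Phi>'[measurable]: "\<Phi>' \<in> borel_measurable borel" and \<Phi>eq: "AE y in lborel. \<Phi> y = \<Phi>' y"
    using lebesgue_measurable_Borel_representative[OF locally_integrable_imp_measurable[OF \<Phi>]] by blast
  have "\<exists>B. B \<in> borel_measurable borel \<and> (AE y in lborel. A i y = B y)" if "i \<in> {1..m}" for i
    using lebesgue_measurable_Borel_representative[OF A[OF that]] by blast
  then obtain A' where A'[measurable]: "\<And>i. i \<in> {1..m} \<Longrightarrow> A' i \<in> borel_measurable borel"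
    and Aeq: "\<And>i. i \<in> {1..m} \<Longrightarrow> AE y in lborel. A i y = A' i y"
    by metis
  \<comment> \<open>A Borel version of the weight is needed as a density of
    \<open>lborel\<close>.\<close>
  obtain w0 where w0[measurable]: "w0 \<in> borel_measurable borel" and w0eq: "AE x in lborel. w x = w0 x"
    using lebesgue_measurable_Borel_representative[OF weight_measurable[OF w]] by blast
  have good: "AE y in lborel. \<Phi> y = \<Phi>' y \<and> (\<forall>i\<in>{1..m}. A i y = A' i y \<and> (\<Phi>' y \<noteq> 0 \<longrightarrow> det (A' i y) \<noteq> 0))"
  proof -
    have "AE y in lborel. \<forall>i\<in>{1..m}. A i y = A' i y" by (rule AE_finite_allI) (use Aeq in auto)
    moreover have "AE y in lborel. \<forall>i\<in>{1..m}. \<Phi> y \<noteq> 0 \<longrightarrow> det (A i y) \<noteq> 0"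
      by (rule AE_finite_allI) (use det in \<open>auto simp: AE_completion_iff\<close>)
    ultimately show ?thesis using \<Phi>eq by eventually_elim auto
  qed
  define \<phi> where "\<phi> y = norm (\<Phi>' y) / norm y ^ CARD('n)" for y
  have \<phi>[measurable]: "\<phi> \<in> borel_measurable borel" unfolding \<phi>_def by measurable
  have \<phi>0: "0 \<le> \<phi> y" for y by (simp add: \<phi>_def)
  define D where "D y = (\<Prod>i=1..m. kernel_factor (qi i) (l i) \<xi> \<eta> \<delta>1 \<delta>2 (A' i y))" for y
  have D[measurable]: "D \<in> borel_measurable borel" unfolding D_def by measurable
  have D0: "0 \<le> D y" for y by (auto simp: D_def intro!: prod_nonneg kernel_factor_nonneg)
  obtain \<kappa> where \<kappa>0: "0 \<le> \<kappa>" and \<kappa>: "(\<integral>\<^sup>+y. ennreal (\<phi> y * D y) \<partial>lborel) \<le> ennreal \<kappa>"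
  proof -
    have "C4 m \<Phi> A qi l \<xi> \<eta> \<delta>1 \<delta>2 = (\<integral>\<^sup>+y. ennreal (\<phi> y * D y) \<partial>lborel)"
      unfolding C4_def nn_integral_completion mult.assoc C4_integrand_eq
    proof (rule nn_integral_cong_AE)
      show "AE y in lborel. ennreal (norm (\<Phi> y) / norm y ^ CARD('n)
          * (\<Prod>i=1..m. kernel_factor (qi i) (l i) \<xi> \<eta> \<delta>1 \<delta>2 (A i y))) = ennreal (\<phi> y * D y)"
        using good by eventually_elim (simp add: \<phi>_def D_def)
    qed
    with C4 have "(\<integral>\<^sup>+y. ennreal (\<phi> y * D y) \<partial>lborel) = ennreal (enn2real (C4 m \<Phi> A qi l \<xi> \<eta> \<delta>1 \<delta>2))"
      by (simp add: less_top)
    then show ?thesis using that[of "enn2real (C4 m \<Phi> A qi l \<xi> \<eta> \<delta>1 \<delta>2)"] by simp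
  qed
  obtain C where C: "0 < C" and slice:
    "\<And>A R f N. \<lbrakk>0 < R; \<And>i. i \<in> {1..m} \<Longrightarrow> det (A i) \<noteq> 0; \<And>i. i \<in> {1..m} \<Longrightarrow> f i \<in> borel_measurable borel;
      \<And>i. i \<in> {1..m} \<Longrightarrow> 0 \<le> N i;
      \<And>i \<rho>. \<lbrakk>i \<in> {1..m}; 0 < \<rho>\<rbrakk> \<Longrightarrow> (\<integral>\<^sup>+x\<in>ball 0 \<rho>. ennreal (norm (f i x) powr qi i * w x) \<partial>lebesgue)
        \<le> ennreal ((N i * ball_weight v \<rho> powr (l i + 1 / qi i)) powr qi i)\<rbrakk>
     \<Longrightarrow> (\<integral>\<^sup>+x\<in>ball 0 R. ennreal ((\<Prod>i=1..m. norm (f i (A i *v x) :: complex)) powr p * w x) \<partial>lebesgue)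
        \<le> ennreal ((C * (\<Prod>i=1..m. kernel_factor (qi i) (l i) \<xi> \<eta> \<delta>1 \<delta>2 (A i)) * (\<Prod>i=1..m. N i)
            * ball_weight v R powr ((\<Sum>i=1..m. l i) + 1 / p)) powr p)"
    using nn_integral_slice_le[OF mw \<xi> mv \<eta> crit \<delta>1 \<delta>2 q qi sum l p r' dom] by blast
  show ?thesis
  \<comment> \<open>\<kappa> may be 0, while the constant has to be positive; hence \<kappa> +
    1.\<close>
  proof (rule that[of "(\<kappa> + 1) * C"])
    show "0 < (\<kappa> + 1) * C" using \<kappa>0 C by simp
    fix f :: "nat \<Rightarrow> real^'n \<Rightarrow> complex"
    assume f: "\<And>i. i \<in> {1..m} \<Longrightarrow> f i \<in> morrey_space v w (qi i) (l i)"
    define N where "N i = enn2real (morrey_norm v w (qi i) (l i) (f i))" for i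
    have N0: "0 \<le> N i" for i by (simp add: N_def)
    define NN where "NN = (\<Prod>i=1..m. N i)"
    have NN: "0 \<le> NN" by (simp add: NN_def N0 prod_nonneg)
    have Nprod: "(\<Prod>i=1..m. morrey_norm v w (qi i) (l i) (f i)) = ennreal NN"
    proof -
      have "morrey_norm v w (qi i) (l i) (f i) = ennreal (N i)" if "i \<in> {1..m}" for i
        using f[OF that] by (simp add: morrey_space_def N_def less_top)
      then have "(\<Prod>i=1..m. morrey_norm v w (qi i) (l i) (f i)) = (\<Prod>i=1..m. ennreal (N i))"
        by (intro prod.cong) auto
      then show ?thesis by (simp add: NN_def prod_ennreal N0)
    qed
    have "\<exists>g. g \<in> borel_measurable borel \<and> (AE x in lborel. f i x = g x)" if "i \<in> {1..m}" for i
      using lebesgue_measurable_Borel_representative[of "f i"] f[OF that] unfolding morrey_space_def by blast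
    then obtain f' where f'[measurable]: "\<And>i. i \<in> {1..m} \<Longrightarrow> f' i \<in> borel_measurable borel"
      and feq: "\<And>i. i \<in> {1..m} \<Longrightarrow> AE x in lborel. f i x = f' i x"
      by metis
    have bound': "(\<integral>\<^sup>+x\<in>ball 0 \<rho>. ennreal (norm (f' i x) powr qi i * w x) \<partial>lebesgue)
        \<le> ennreal ((N i * ball_weight v \<rho> powr (l i + 1 / qi i)) powr qi i)" if i: "i \<in> {1..m}" and \<rho>: "0 < \<rho>" for i \<rho>
    proof -
      have "(\<integral>\<^sup>+x\<in>ball 0 \<rho>. ennreal (norm (f' i x) powr qi i * w x) \<partial>lebesgue)
        = (\<integral>\<^sup>+x\<in>ball 0 \<rho>. ennreal (norm (f i x) powr qi i * w x) \<partial>lebesgue)"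
        unfolding nn_integral_completion
      proof (rule nn_integral_cong_AE)
        show "AE x in lborel. ennreal (norm (f' i x) powr qi i * w x) * indicator (ball 0 \<rho>) x
            = ennreal (norm (f i x) powr qi i * w x) * indicator (ball 0 \<rho>) x"
          using feq[OF i] by eventually_elim simp
      qed
      also have "\<dots> \<le> ennreal ((N i * ball_weight v \<rho> powr (l i + 1 / qi i)) powr qi i)"
        unfolding N_def using qi[OF i] by (intro morrey_space_ball_bound[OF f[OF i] _ v Vpos \<rho>]) auto
      finally show ?thesis .
    qed
    define g where "g x y = \<Phi>' y / of_real (norm y ^ CARD('n)) * (\<Prod>i=1..m. f' i (A' i y *v x))" for x y
    have g[measurable]: "case_prod g \<in> borel_measurable (borel \<Otimes>\<^sub>M borel)"
      unfolding g_def by measurable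
    define F where "F x y = \<phi> y * (\<Prod>i=1..m. norm (f' i (A' i y *v x)))" for x y
    have F[measurable]: "case_prod F \<in> borel_measurable (borel \<Otimes>\<^sub>M borel)"
      unfolding F_def by measurable
    have F0: "0 \<le> F x y" for x y by (simp add: F_def \<phi>0 prod_nonneg)
    have norm_g: "norm (g x y) = F x y" for x y
      by (simp add: g_def F_def \<phi>_def norm_mult norm_divide prod_norm norm_power)

    \<comment> \<open>For fixed y with \<Phi>' y nonzero, replacing f by f' matters only for x in
      the preimage of a null set under a nonsingular matrix. This holds for almost every y; Fubini
      exchanges the two quantifiers.\<close>
    have same: "AE x in lborel. AE y in lborel. hausdorff_integrand m \<Phi> A f x y = g x y"
    proof -
      have "\<exists>Z. (\<forall>x. x \<notin> Z \<longrightarrow> f i x = f' i x) \<and> Z \<in> null_sets lborel" if i: "i \<in> {1..m}" for i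
      proof -
        obtain Z where "\<And>x. x \<in> space lborel - Z \<Longrightarrow> f i x = f' i x" "Z \<in> null_sets lborel"
          using AE_E3[OF feq[OF i]] by blast
        then show ?thesis by (intro exI[of _ Z]) auto
      qed
      then obtain Z where Z: "\<And>i x. \<lbrakk>i \<in> {1..m}; x \<notin> Z i\<rbrakk> \<Longrightarrow> f i x = f' i x"
        and Z0: "\<And>i. i \<in> {1..m} \<Longrightarrow> Z i \<in> null_sets lborel" by metis
      \<comment> \<open>Null sets of \<open>lborel\<close> are Borel, so the condition on (x, y)
        below is measurable, as \<open>AE_commute\<close> demands.\<close>
      have [measurable]: "Z i \<in> sets borel" if "i \<in> {1..m}" for i using Z0[OF that] by (auto simp: null_sets_def)
      have "AE x in lborel. AE y in lborel. \<Phi>' y \<noteq> 0 \<longrightarrow> (\<forall>i\<in>{1..m}. A' i y *v x \<notin> Z i)"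
      proof (subst lborel_pair.AE_commute)
        show "{x \<in> space (lborel \<Otimes>\<^sub>M lborel). \<Phi>' (snd x) \<noteq> 0 \<longrightarrow> (\<forall>i\<in>{1..m}. A' i (snd x) *v fst x \<notin> Z i)}
            \<in> sets (lborel \<Otimes>\<^sub>M lborel)"
          by measurable
        show "AE y in lborel. AE x in lborel. \<Phi>' y \<noteq> 0 \<longrightarrow> (\<forall>i\<in>{1..m}. A' i y *v x \<notin> Z i)"
          using good
        proof eventually_elim
          case (elim y)
          show ?case
          proof (cases "\<Phi>' y = 0")
            case False
            have "AE x in lborel. \<forall>i\<in>{1..m}. A' i y *v x \<notin> Z i"
              by (rule AE_finite_allI) (use False elim Z0 in \<open>auto intro!: AE_linear_image_notin_null\<close>)
            then show ?thesis by eventually_elim auto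
          qed auto
        qed
      qed
      then show ?thesis
      proof eventually_elim
        case (elim x)
        show ?case using elim good
        proof eventually_elim
          case (elim y)
          show ?case
          proof (cases "\<Phi>' y = 0")
            case False
            then have "f i (A i y *v x) = f' i (A' i y *v x)" if "i \<in> {1..m}" for i
              using elim that Z by auto
            then show ?thesis using elim by (simp add: hausdorff_integrand_def g_def)
          qed (use elim in \<open>simp add: hausdorff_integrand_def g_def\<close>)
        qed
      qed
    qed

    have mink: "(AE x in lborel. x \<in> ball 0 R \<longrightarrow> (\<integral>\<^sup>+y. ennreal (F x y) \<partial>lborel) < \<infinity>)
      \<and> (\<integral>\<^sup>+x\<in>ball 0 R. ennreal (enn2real (\<integral>\<^sup>+y. ennreal (F x y) \<partial>lborel) powr p * w x) \<partial>lebesgue)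
          \<le> ennreal ((\<kappa> * (C * NN * ball_weight v R powr (ls + 1 / p))) powr p)" if R: "0 < R" for R
    proof -
      define c where "c = C * NN * ball_weight v R powr (ls + 1 / p)"
      have c: "0 \<le> c" using C NN by (simp add: c_def)
      \<comment> \<open>The measure w dx cut off to the ball: its total mass is the weight of the
        ball, so it is finite and in particular sigma-finite.\<close>
      define \<mu> where "\<mu> x = ennreal (w0 x) * indicator (ball 0 R) x" for x
      have [measurable]: "ball (0::real^'n) R \<in> sets borel" by simp
      have [measurable]: "\<mu> \<in> borel_measurable borel" unfolding \<mu>_def by measurable
      have dens: "(\<integral>\<^sup>+x. ennreal (h x) \<partial>density lborel \<mu>) = (\<integral>\<^sup>+x\<in>ball 0 R. ennreal (h x * w x) \<partial>lebesgue)"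
        if [measurable]: "h \<in> borel_measurable borel" and h0: "\<And>x. 0 \<le> h x" for h
      proof -
        have "(\<integral>\<^sup>+x. ennreal (h x) \<partial>density lborel \<mu>) = (\<integral>\<^sup>+x. \<mu> x * ennreal (h x) \<partial>lborel)"
          by (rule nn_integral_density) auto
        also have "\<dots> = (\<integral>\<^sup>+x\<in>ball 0 R. ennreal (h x * w x) \<partial>lborel)"
        proof (rule nn_integral_cong_AE)
          show "AE x in lborel. \<mu> x * ennreal (h x) = ennreal (h x * w x) * indicator (ball 0 R) x"
            using w0eq
          proof eventually_elim
            case (elim x)
            have "ennreal (h x * w x) = ennreal (h x) * ennreal (w x)" by (rule ennreal_mult'[OF h0])
            then show ?case using elim by (simp add: \<mu>_def mult_ac)
          qed
        qed
        finally show ?thesis by (simp only: nn_integral_completion)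
      qed
      have "emeasure (density lborel \<mu>) (space (density lborel \<mu>)) = weight_measure w (ball 0 R)"
        using dens[of "\<lambda>_. 1"] by (simp add: weight_measure_def)
      then have "finite_measure (density lborel \<mu>)"
        using weight_measure_ball[OF w, of 0 R] by (intro finite_measureI) auto
      then interpret \<mu>: finite_measure "density lborel \<mu>" .
      have "(AE x in density lborel \<mu>. (\<integral>\<^sup>+y. ennreal (F x y) \<partial>lborel) < \<infinity>)
        \<and> (\<integral>\<^sup>+x. ennreal (enn2real (\<integral>\<^sup>+y. ennreal (F x y) \<partial>lborel) powr p) \<partial>density lborel \<mu>) \<le> ennreal ((\<kappa> * c) powr p)"
      proof (rule nn_integral_Minkowski[OF _ _ _ F0 _ _ p c \<kappa>0 \<kappa>])
        show "sigma_finite_measure (density lborel \<mu>)" by unfold_locales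
        show "sigma_finite_measure (lborel :: (real^'n) measure)" by unfold_locales
        show "case_prod F \<in> borel_measurable (density lborel \<mu> \<Otimes>\<^sub>M lborel)" by measurable
        show "(\<lambda>y. \<phi> y * D y) \<in> borel_measurable lborel" by measurable
        show "0 \<le> \<phi> y * D y" for y using \<phi>0 D0 by simp
        show "AE y in lborel. (\<integral>\<^sup>+x. ennreal (F x y powr p) \<partial>density lborel \<mu>) \<le> ennreal ((\<phi> y * D y * c) powr p)"
          using good
        proof eventually_elim
          case (elim y)
          have "(\<integral>\<^sup>+x. ennreal (F x y powr p) \<partial>density lborel \<mu>) = (\<integral>\<^sup>+x\<in>ball 0 R. ennreal (F x y powr p * w x) \<partial>lebesgue)"
            by (rule dens) auto
          also have "\<dots> \<le> ennreal ((\<phi> y * D y * c) powr p)"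
          \<comment> \<open>Where \<Phi>' vanishes nothing is known about the determinants, but
            there F is 0.\<close>
          proof (cases "\<Phi>' y = 0")
            case True
            then show ?thesis by (simp add: F_def \<phi>_def)
          next
            case False
            have S: "(\<integral>\<^sup>+x\<in>ball 0 R. ennreal ((\<Prod>i=1..m. norm (f' i (A' i y *v x))) powr p * w x) \<partial>lebesgue)
              \<le> ennreal ((C * D y * NN * ball_weight v R powr (ls + 1 / p)) powr p)"
              unfolding D_def NN_def ls_def
              by (rule slice[OF R _ f' N0 bound']) (use elim False in auto)
            have "(\<integral>\<^sup>+x\<in>ball 0 R. ennreal (F x y powr p * w x) \<partial>lebesgue)
              = ennreal (\<phi> y powr p) * (\<integral>\<^sup>+x\<in>ball 0 R. ennreal ((\<Prod>i=1..m. norm (f' i (A' i y *v x))) powr p * w x) \<partial>lebesgue)"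
            proof -
              have [measurable]: "w \<in> borel_measurable lebesgue" by (rule weight_measurable[OF w])
              have [measurable]: "(\<lambda>x. (\<Prod>i=1..m. norm (f' i (A' i y *v x))) powr p) \<in> borel_measurable lebesgue"
                by (intro measurable_completion) measurable
              have [measurable]: "ball (0::real^'n) R \<in> sets lebesgue" by simp
              have "ennreal (F x y powr p * w x) * indicator (ball 0 R) x
                = ennreal (\<phi> y powr p) * (ennreal ((\<Prod>i=1..m. norm (f' i (A' i y *v x))) powr p * w x) * indicator (ball 0 R) x)" for x
                using \<phi>0[of y] by (simp add: F_def powr_mult prod_nonneg mult.assoc ennreal_mult')
              moreover have "(\<lambda>x. ennreal ((\<Prod>i=1..m. norm (f' i (A' i y *v x))) powr p * w x) * indicator (ball 0 R) x)
                  \<in> borel_measurable lebesgue"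
                by measurable
              ultimately show ?thesis by (simp only: nn_integral_cmult)
            qed
            also have "\<dots> \<le> ennreal (\<phi> y powr p) * ennreal ((C * D y * NN * ball_weight v R powr (ls + 1 / p)) powr p)"
              by (intro mult_left_mono S) auto
            also have "\<dots> = ennreal ((\<phi> y * (C * D y * NN * ball_weight v R powr (ls + 1 / p))) powr p)"
              using \<phi>0[of y] C D0[of y] NN by (simp add: ennreal_mult[symmetric] powr_mult)
            also have "\<phi> y * (C * D y * NN * ball_weight v R powr (ls + 1 / p)) = \<phi> y * D y * c"
              by (simp add: c_def mult_ac)
            finally show ?thesis .
          qed
          finally show ?case .
        qed
      qed
      then have 1: "AE x in density lborel \<mu>. (\<integral>\<^sup>+y. ennreal (F x y) \<partial>lborel) < \<infinity>"
        and 2: "(\<integral>\<^sup>+x. ennreal (enn2real (\<integral>\<^sup>+y. ennreal (F x y) \<partial>lborel) powr p) \<partial>density lborel \<mu>) \<le> ennreal ((\<kappa> * c) powr p)"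
        by auto
      \<comment> \<open>Minkowski's inequality gives finiteness only almost everywhere for w dx;
        positivity of w transfers it to Lebesgue measure on the ball.\<close>
      have "AE x in lborel. 0 < \<mu> x \<longrightarrow> (\<integral>\<^sup>+y. ennreal (F x y) \<partial>lborel) < \<infinity>"
        using 1 by (subst (asm) AE_density) auto
      moreover have "AE x in lborel. 0 < w x"
        using muckenhoupt_AE_pos[OF mw \<xi> crit(1)] by (simp add: AE_completion_iff)
      ultimately have "AE x in lborel. x \<in> ball 0 R \<longrightarrow> (\<integral>\<^sup>+y. ennreal (F x y) \<partial>lborel) < \<infinity>"
        using w0eq
      proof eventually_elim
        case (elim x)
        show ?case
        proof
          assume "x \<in> ball 0 R"
          then have "0 < \<mu> x" using elim(2,3) by (simp add: \<mu>_def)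
          then show "(\<integral>\<^sup>+y. ennreal (F x y) \<partial>lborel) < \<infinity>" using elim(1) by blast
        qed
      qed
      moreover have "(\<integral>\<^sup>+x\<in>ball 0 R. ennreal (enn2real (\<integral>\<^sup>+y. ennreal (F x y) \<partial>lborel) powr p * w x) \<partial>lebesgue)
          \<le> ennreal ((\<kappa> * c) powr p)"
        using 2 by (subst (asm) dens) auto
      ultimately show ?thesis unfolding c_def by blast
    qed
    have fin: "AE x in lborel. (\<integral>\<^sup>+y. ennreal (F x y) \<partial>lborel) < \<infinity>"
    proof -
      have "AE x in lborel. \<forall>k::nat. x \<in> ball 0 (1 + real k) \<longrightarrow> (\<integral>\<^sup>+y. ennreal (F x y) \<partial>lborel) < \<infinity>"
        unfolding AE_all_countable by (intro allI mink[THEN conjunct1]) simp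
      then show ?thesis
      proof eventually_elim
        case (elim x)
        obtain k :: nat where "norm x < real k" using reals_Archimedean2 by blast
        then have "x \<in> ball 0 (1 + real k)" by simp
        then show ?case using elim by blast
      qed
    qed
    have int: "AE x in lborel. integrable lebesgue (hausdorff_integrand m \<Phi> A f x)
        \<and> hausdorff_operator m \<Phi> A f x = (\<integral>y. g x y \<partial>lborel)
        \<and> norm (hausdorff_operator m \<Phi> A f x) \<le> enn2real (\<integral>\<^sup>+y. ennreal (F x y) \<partial>lborel)"
      using fin same
    proof eventually_elim
      case (elim x)
      let ?h = "hausdorff_integrand m \<Phi> A f x"
      have gx[measurable]: "g x \<in> borel_measurable borel" by measurable
      have gi: "integrable lborel (g x)"
        using elim(1) by (intro integrableI_bounded) (auto simp: norm_g)
      then have gi': "integrable lebesgue (g x)" by (subst integrable_completion) auto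
      have gl: "g x \<in> borel_measurable lebesgue" by (intro measurable_completion) simp
      \<comment> \<open>The original integrand is only known to agree almost everywhere with a Borel
        function; completeness of \<open>lebesgue\<close> makes this enough for its
        measurability.\<close>
      have eq: "AE y in lebesgue. g x y = ?h y"
        using elim(2) unfolding AE_completion_iff by eventually_elim simp
      have hl: "?h \<in> borel_measurable lebesgue" by (rule borel_measurable_AE[OF gl eq])
      have "integrable lebesgue ?h" using gi' integrable_cong_AE[OF gl hl eq] by simp
      moreover have "hausdorff_operator m \<Phi> A f x = (\<integral>y. g x y \<partial>lborel)"
        unfolding hausdorff_operator_def integral_cong_AE[OF gl hl eq, symmetric]
        by (rule integral_completion) simp
      moreover have "norm (\<integral>y. g x y \<partial>lborel) \<le> enn2real (\<integral>\<^sup>+y. ennreal (F x y) \<partial>lborel)"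
      proof -
        have "ennreal (norm (\<integral>y. g x y \<partial>lborel)) \<le> (\<integral>\<^sup>+y. ennreal (F x y) \<partial>lborel)"
          using integral_norm_bound_ennreal[OF gi] by (simp add: norm_g)
        then have "enn2real (ennreal (norm (\<integral>y. g x y \<partial>lborel))) \<le> enn2real (\<integral>\<^sup>+y. ennreal (F x y) \<partial>lborel)"
          using elim(1) by (intro enn2real_mono) auto
        then show ?thesis by simp
      qed
      ultimately show ?case by simp
    qed
    let ?H = "hausdorff_operator m \<Phi> A f"
    have H: "?H \<in> borel_measurable lebesgue"
    proof (rule borel_measurable_AE)
      show "(\<lambda>x. \<integral>y. g x y \<partial>lborel) \<in> borel_measurable lebesgue"
        by (intro measurable_completion) measurable
      show "AE x in lebesgue. (\<integral>y. g x y \<partial>lborel) = ?H x"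
        using int unfolding AE_completion_iff by eventually_elim simp
    qed
    have ball: "(\<integral>\<^sup>+x\<in>ball 0 R. ennreal (norm (?H x) powr p * w x) \<partial>lebesgue)
      \<le> ennreal (((\<kappa> + 1) * C * NN * ball_weight v R powr (ls + 1 / p)) powr p)" if R: "0 < R" for R
    proof -
      have "(\<integral>\<^sup>+x\<in>ball 0 R. ennreal (norm (?H x) powr p * w x) \<partial>lebesgue)
        \<le> (\<integral>\<^sup>+x\<in>ball 0 R. ennreal (enn2real (\<integral>\<^sup>+y. ennreal (F x y) \<partial>lborel) powr p * w x) \<partial>lebesgue)"
      proof (rule nn_integral_mono_AE)
        show "AE x in lebesgue. ennreal (norm (?H x) powr p * w x) * indicator (ball 0 R) x
          \<le> ennreal (enn2real (\<integral>\<^sup>+y. ennreal (F x y) \<partial>lborel) powr p * w x) * indicator (ball 0 R) x"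
          using int unfolding AE_completion_iff
        proof eventually_elim
          case (elim x)
          then have "norm (?H x) powr p \<le> enn2real (\<integral>\<^sup>+y. ennreal (F x y) \<partial>lborel) powr p"
            using p by (intro powr_mono2) auto
          then show ?case
            by (intro mult_right_mono ennreal_leI weight_nonneg[OF w]) auto
        qed
      qed
      also have "\<dots> \<le> ennreal ((\<kappa> * (C * NN * ball_weight v R powr (ls + 1 / p))) powr p)"
        using mink[OF R] by blast
      also have "\<dots> \<le> ennreal (((\<kappa> + 1) * (C * NN * ball_weight v R powr (ls + 1 / p))) powr p)"
        using \<kappa>0 C NN p by (intro ennreal_leI powr_mono2 mult_right_mono) auto
      finally show ?thesis by (simp add: mult.assoc)
    qed
    have "0 \<le> (\<kappa> + 1) * C * NN" using \<kappa>0 C NN by simp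
    note M = morrey_space_ballI[OF H _ v Vpos this ball]
    have "morrey_norm v w p ls ?H \<le> ennreal ((\<kappa> + 1) * C * NN)" by (rule M(2)) (use p in auto)
    also have "\<dots> = ennreal ((\<kappa> + 1) * C) * (\<Prod>i=1..m. morrey_norm v w (qi i) (l i) (f i))"
      unfolding Nprod using \<kappa>0 C NN by (simp add: ennreal_mult)
    finally have norm: "morrey_norm v w p ls ?H \<le> \<dots>" .
    have mem: "?H \<in> morrey_space v w p ls" by (rule M(1)) (use p in auto)
    have "AE x in lebesgue. integrable lebesgue (hausdorff_integrand m \<Phi> A f x)"
      using int unfolding AE_completion_iff by eventually_elim simp
    with norm mem show "(AE x in lebesgue. integrable lebesgue (hausdorff_integrand m \<Phi> A f x))
      \<and> ?H \<in> morrey_space v w p (\<Sum>i=1..m. l i)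
      \<and> morrey_norm v w p (\<Sum>i=1..m. l i) ?H
          \<le> ennreal ((\<kappa> + 1) * C) * (\<Prod>i=1..m. morrey_norm v w (qi i) (l i) (f i))"
      unfolding ls_def by blast
  qed
qed

theorem theorem3p7:
  fixes m :: nat
    and \<Phi> :: "real^'n \<Rightarrow> complex"
    and A :: "nat \<Rightarrow> real^'n \<Rightarrow> real^'n^'n"
    and v \<omega> :: "real^'n \<Rightarrow> real"
    and qi l :: "nat \<Rightarrow> real"
    and q qs ls \<xi> \<eta> r\<omega>' \<delta>1 \<delta>2 :: real
  assumes "1 \<le> m"
    and "locally_integrable \<Phi>"
    and "\<And>i. i \<in> {1..m} \<Longrightarrow> A i \<in> borel_measurable lebesgue"
    and "\<And>i. i \<in> {1..m} \<Longrightarrow> AE y in lebesgue. \<Phi> y \<noteq> 0 \<longrightarrow> det (A i y) \<noteq> 0"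
    and "1 \<le> q"
    and "\<And>i. i \<in> {1..m} \<Longrightarrow> 1 \<le> qi i"
    and "(\<Sum>i=1..m. 1 / qi i) = 1 / q"
    and "1 \<le> qs" and "1 \<le> \<xi>" and "1 \<le> \<eta>"
    and "\<And>i. i \<in> {1..m} \<Longrightarrow> - (1 / qi i) < l i \<and> l i < 0"
    and "muckenhoupt \<xi> \<omega>" and "muckenhoupt \<eta> v"
    and "\<bar>critical_index \<omega>\<bar> \<noteq> \<infinity>" and "\<bar>critical_index v\<bar> \<noteq> \<infinity>"
    and "\<exists>C>0. \<forall>R>0. weight_measure \<omega> (ball 0 R) \<le> ennreal C * weight_measure v (ball 0 R)"
    and "1 / real_of_ereal (critical_index \<omega>) + 1 / r\<omega>' = 1"
    and "q > qs * \<xi> * r\<omega>'"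
    and "1 < \<delta>1" and "ereal \<delta>1 < critical_index \<omega>"
    and "1 < \<delta>2" and "ereal \<delta>2 < critical_index v"
    and "ls = (\<Sum>i=1..m. l i)"
    and "C4 m \<Phi> A qi l \<xi> \<eta> \<delta>1 \<delta>2 < \<infinity>"
  shows "\<exists>C>0. \<forall>f. (\<forall>i\<in>{1..m}. f i \<in> morrey_space v \<omega> (qi i) (l i)) \<longrightarrow>
           (AE x in lebesgue. integrable lebesgue (hausdorff_integrand m \<Phi> A f x))
         \<and> hausdorff_operator m \<Phi> A f \<in> morrey_space v \<omega> qs ls
         \<and> morrey_norm v \<omega> qs ls (hausdorff_operator m \<Phi> A f)
             \<le> ennreal C * (\<Prod>i=1..m. morrey_norm v \<omega> (qi i) (l i) (f i))"
proof -
  note as = assms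
  have crit: "critical_index \<omega> \<noteq> \<infinity>" "critical_index v \<noteq> \<infinity>" using as(14,15) by auto
  have "- (1 / qi i) < l i" if "i \<in> {1..m}" for i using as(11)[OF that] by simp
  from hausdorff_operator_morrey_bound[OF as(2) as(3) as(4) as(5) as(6) as(7) as(8) as(9) as(10) this
      as(12) as(13) crit as(16) as(17) as(18) as(19) as(20) as(21) as(22) as(24)]
  obtain C where "0 < C" and "\<And>f. (\<And>i. i \<in> {1..m} \<Longrightarrow> f i \<in> morrey_space v \<omega> (qi i) (l i)) \<Longrightarrow>
      (AE x in lebesgue. integrable lebesgue (hausdorff_integrand m \<Phi> A f x))
      \<and> hausdorff_operator m \<Phi> A f \<in> morrey_space v \<omega> qs (\<Sum>i=1..m. l i)
      \<and> morrey_norm v \<omega> qs (\<Sum>i=1..m. l i) (hausdorff_operator m \<Phi> A f)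
          \<le> ennreal C * (\<Prod>i=1..m. morrey_norm v \<omega> (qi i) (l i) (f i))"
    by blast
  then show ?thesis unfolding as(23) by blast
qed

end
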